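(* Let $(P_n)_{n\ge 1}$ be a sequence of random polynomials defined on a common probability space such that, for each $n$, $P_n(z)=\sum_{i=0}^n a_i z^i$ (with $a_i=a_i^{(n)}$) is a random log-concave polynomial of degree $n$ drawn from the uniform model. Denote the roots of $P_n$ in $\mathbb{C}$, counted with multiplicity, by $\zeta_{n,1},\dots,\zeta_{n,n}$. Then, almost surely, as $n\to\infty$, $$ d_L\Big(\frac1n\sum_{k=1}^n \delta_{\zeta_{n,k}},\ \mathsf{U}(\mathbb{S}^1)\Big)\to 0,$$ where $\mathsf{U}(\mathbb{S}^1)$ is the uniform probability distribution on the unit circle $\mathbb{S}^1=\{z\in\mathbb{C}:|z|=1\}$ and $d_L$ is the Lévy–Prokhorov metric on probability measures on $\mathbb{C}$.
   Context: Uniform model: let $U_0,\dots,U_n$ be i.i.d. uniform random variables on $(0,1)$ and let $\mathcal{L}=\{U_{i-1}U_{i+1}\le U_i^2 \text{ for all } 1\le i\le n-1\}$. Let $(a_0,\dots,a_n)$ have the conditional law of $(U_0,\dots,U_n)$ given $\mathcal{L}$ (i.e. the uniform distribution on the set of log-concave sequences in $[0,1]^{n+1}$). The polynomial $P_n(z)=\sum_{i=0}^n a_i z^i$ is said to be drawn from the uniform model. Almost surely $a_n>0$, so $P_n$ has degree $n$. *)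

theory Defs
  imports "HOL-Probability.Probability" "HOL-Computational_Algebra.Polynomial"
begin

definition log_concave_upto :: "nat \<Rightarrow> (nat \<Rightarrow> real) \<Rightarrow> bool" where
  "log_concave_upto n u \<longleftrightarrow> (\<forall>i. 1 \<le> i \<and> i < n \<longrightarrow> u (i - 1) * u (i + 1) \<le> (u i)\<^sup>2)"

definition iid_uniform :: "nat \<Rightarrow> (nat \<Rightarrow> real) measure" where
  "iid_uniform n = PiM {..n} (\<lambda>_. uniform_measure lborel {0<..<1})"

text \<open>The library's \<^const>\<open>uniform_measure\<close> \<open>N A\<close> is the law \<open>N\<close> conditioned on the event \<open>A\<close>:
  it gives \<open>B\<close> the mass \<open>N (A \<inter> B) / N A\<close>. The event used below has
  positive probability.\<close>

definition uniform_model :: "nat \<Rightarrow> (nat \<Rightarrow> real) measure" where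
  "uniform_model n =
     uniform_measure (iid_uniform n) {u \<in> space (iid_uniform n). log_concave_upto n u}"

definition coeff_poly :: "nat \<Rightarrow> (nat \<Rightarrow> real) \<Rightarrow> complex poly" where
  "coeff_poly n a = (\<Sum>i\<le>n. monom (complex_of_real (a i)) i)"

text \<open>The image of the uniform distribution on the indices \<open>1, \<dots>, n\<close> under \<open>z\<close>, that is,
  \<open>1/n\<close> times the sum of the point masses at \<open>z 1, \<dots>, z n\<close>, as a Borel measure.\<close>

definition empirical_measure :: "nat \<Rightarrow> (nat \<Rightarrow> complex) \<Rightarrow> complex measure" where
  "empirical_measure n z = distr (uniform_count_measure {1..n}) borel z"

definition uniform_circle :: "complex measure" where
  "uniform_circle = distr (uniform_measure lborel {0..<2 * pi}) borel cis"

definition levy_prokhorov :: "'a::metric_space measure \<Rightarrow> 'a measure \<Rightarrow> real" where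
  "levy_prokhorov \<mu> \<nu> =
     Inf {\<epsilon>. \<epsilon> > 0 \<and> (\<forall>A \<in> sets borel.
       measure \<mu> A \<le> measure \<nu> (\<Union>x\<in>A. ball x \<epsilon>) + \<epsilon> \<and>
       measure \<nu> A \<le> measure \<mu> (\<Union>x\<in>A. ball x \<epsilon>) + \<epsilon>)}"

end

theory Submission
  imports Defs "HOL-Complex_Analysis.Complex_Analysis"
    "HOL-Computational_Algebra.Fundamental_Theorem_Algebra" "HOL-Real_Asymp.Real_Asymp"
begin

text \<open>
  \<^emph>\<open>Coefficients.\<close> For a log-concave sequence \<open>u\<close> in \<open>(0,1)\<close>, if the positive part of the slope of
  \<open>ln u\<close> drops by at least \<open>s\<close> at the index \<open>j\<close>, then multiplying \<open>u i\<close> by \<open>exp (s (j - i))\<close> for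
  \<open>i < j\<close> keeps the sequence log-concave and in \<open>(0,1)\<close>. The Jacobian of this diagonal map bounds the
  conditional probability of such a drop by \<open>exp (- s j (j + 1) / 2)\<close>. Taking \<open>s\<close> of order
  \<open>ln n / j\<^sup>2\<close>, the union bound and Borel--Cantelli show that almost surely, for large \<open>n\<close>, no drop of
  this size occurs, and summing the drops gives \<open>a i \<le> exp (O(ln\<^sup>2 n)) a 0\<close> for all \<open>i\<close>. By reversal
  the same holds with \<open>a n\<close> in place of \<open>a 0\<close>.

  \<^emph>\<open>Roots.\<close> Hence \<open>\<bar>P z\<bar>\<^sup>2 \<le> exp (o(n)) a 0 a n\<close> on the unit circle. Replacing every root \<open>\<zeta>\<close> by its
  radial projection \<open>w\<close> to the circle can only decrease \<open>\<bar>P z\<bar>\<^sup>2 / (a 0 a n)\<close>, and does so by a definite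
  factor for each root away from the circle. So \<open>Q z = \<Prod> (z - w)\<close> is at most \<open>exp (o(n))\<close> on
  the circle, and since \<open>\<bar>Q 0\<bar> = 1\<close> only \<open>o(n)\<close> roots are away from the circle. The logarithm
  \<open>\<Sum> ln (1 - cnj w z)\<close> has real part \<open>o(n)\<close> in the disc; the Borel--Caratheodory inequality
  bounds its Taylor coefficients, which are the power sums of the \<open>w\<close>, by \<open>o(n)\<close>. Weyl's criterion
  concludes.
\<close>

section \<open>Roots of polynomials with comparable coefficients\<close>

text \<open>The map w -> w / (2K - w) sends the half-plane Re w < K into the unit disc, so the
  Schwarz lemma applies to its composition with \<open>f\<close>. Taking K > H makes the bound on
  the composition strict; K then decreases to H.\<close>

lemma borel_caratheodory_half:
  fixes f :: "complex \<Rightarrow> complex"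
  assumes hol: "f holomorphic_on ball 0 1" and f0: "f 0 = 0"
    and Re: "\<And>z. norm z < 1 \<Longrightarrow> Re (f z) \<le> H" and H: "H > 0" and z: "norm z \<le> 1/2"
  shows "norm (f z) \<le> 2 * H"
proof -
  have ball: "w \<in> ball 0 1 \<longleftrightarrow> norm w < 1" for w :: complex by simp
  have aux: "norm (f z) \<le> 2 * K" if K: "K > H" for K
  proof -
    have nz: "2 * complex_of_real K - f w \<noteq> 0" if "norm w < 1" for w
      using Re[OF that] K H by (auto simp: complex_eq_iff)
    let ?g = "\<lambda>w. f w / (2 * complex_of_real K - f w)"
    have "?g holomorphic_on ball 0 1"
      using hol nz by (intro holomorphic_intros) auto
    moreover have "norm (?g w) < 1" if w: "norm w < 1" for w
    proof -
      have "(norm (f w))\<^sup>2 < (norm (2 * complex_of_real K - f w))\<^sup>2"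
      proof -
        have "K * Re (f w) < K * K" using Re[OF w] K H by simp
        then show ?thesis
          unfolding cmod_power2 by (simp add: power2_eq_square algebra_simps)
      qed
      then have "norm (f w) < norm (2 * complex_of_real K - f w)"
        by (simp add: power2_less_imp_less)
      then show ?thesis using nz[OF w] by (simp add: norm_divide)
    qed
    ultimately have "norm (?g z) \<le> norm z"
      using f0 z by (intro Schwarz_Lemma) auto
    then have "norm (f z) \<le> norm z * norm (2 * complex_of_real K - f z)"
      using nz[of z] z by (simp add: norm_divide divide_le_eq split: if_splits)
    also have "\<dots> \<le> 1/2 * (2 * K + norm (f z))"
    proof (rule mult_mono)
      show "norm (2 * complex_of_real K - f z) \<le> 2 * K + norm (f z)"
        using norm_triangle_ineq4[of "2 * complex_of_real K" "f z"] K H by simp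
    qed (use z in auto)
    finally show ?thesis by simp
  qed
  show ?thesis
  proof (rule field_le_epsilon)
    fix e :: real assume "e > 0"
    then show "norm (f z) \<le> 2 * H + e" using aux[of "H + e/2"] by simp
  qed
qed

text \<open>At z = 0 this reads off power sums of the \<open>c k\<close> as Taylor coefficients of a
  sum of logarithms. The formula covers the whole open disc so that the induction can differentiate
  it.\<close>

lemma higher_deriv_sum_Ln:
  fixes c :: "'a \<Rightarrow> complex"
  assumes c: "\<And>k. k \<in> I \<Longrightarrow> norm (c k) \<le> 1" and z: "norm z < 1"
  shows "(deriv ^^ Suc m) (\<lambda>z. \<Sum>k\<in>I. Ln (1 - c k * z)) z
           = - (\<Sum>k\<in>I. fact m * c k ^ Suc m / (1 - c k * z) ^ Suc m)"
  using z
proof (induction m arbitrary: z)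
  case (0 z)
  have *: "1 - c k * z \<notin> \<real>\<^sub>\<le>\<^sub>0" if "k \<in> I" for k
  proof -
    have "norm (c k * z) < 1"
      using c[OF that] 0 by (metis mult_left_le_one_le norm_ge_zero norm_mult order_le_less_trans)
    then have "Re (c k * z) < 1" using complex_Re_le_cmod order_le_less_trans by blast
    then show ?thesis by (auto simp: complex_nonpos_Reals_iff)
  qed
  then show ?case
    by (auto intro!: DERIV_imp_deriv derivative_eq_intros sum.cong simp: sum_negf[symmetric] field_simps)
next
  case (Suc m z)
  let ?f = "\<lambda>z. \<Sum>k\<in>I. Ln (1 - c k * z)"
  let ?F = "\<lambda>z. - (\<Sum>k\<in>I. fact m * c k ^ Suc m / (1 - c k * z) ^ Suc m)"
  have *: "1 - c k * z \<noteq> 0" if "k \<in> I" for k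
  proof
    assume "1 - c k * z = 0"
    then have "norm (c k * z) = 1" by simp
    with c[OF that] Suc.prems show False
      by (metis mult_left_le_one_le norm_ge_zero norm_mult not_le order_le_less_trans order_refl)
  qed
  have "(deriv ^^ Suc (Suc m)) ?f z = deriv ((deriv ^^ Suc m) ?f) z" by simp
  also have "\<dots> = deriv ?F z"
    \<comment> \<open>The induction hypothesis holds on the open unit disc, hence in a neighbourhood
      of z, which is what replacing a function under \<open>deriv\<close> requires.\<close>
    by (rule deriv_cong_ev)
       (use Suc in \<open>auto simp: eventually_nhds intro!: exI[of _ "ball 0 1"]\<close>)
  also have "\<dots> = - (\<Sum>k\<in>I. fact (Suc m) * c k ^ Suc (Suc m) / (1 - c k * z) ^ Suc (Suc m))"
  proof (rule DERIV_imp_deriv)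
    have "((\<lambda>z. fact m * c k ^ Suc m / (1 - c k * z) ^ Suc m) has_field_derivative
            fact (Suc m) * c k ^ Suc (Suc m) / (1 - c k * z) ^ Suc (Suc m)) (at z)" if "k \<in> I" for k
    proof -
      have "((\<lambda>z. inverse (1 - c k * z)) has_field_derivative c k * (inverse (1 - c k * z))\<^sup>2) (at z)"
        using *[OF that] by (auto intro!: derivative_eq_intros simp: divide_simps power2_eq_square)
      from DERIV_cmult[OF DERIV_power[OF this, of "Suc m"], of "fact m * c k ^ Suc m"]
      have "((\<lambda>z. fact m * c k ^ Suc m * inverse (1 - c k * z) ^ Suc m) has_field_derivative
            fact (Suc m) * c k ^ Suc (Suc m) * inverse (1 - c k * z) ^ Suc (Suc m)) (at z)"
        by (rule DERIV_cong) (simp add: power2_eq_square algebra_simps)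
      then show ?thesis by (simp add: divide_inverse power_inverse)
    qed
    then show "(?F has_field_derivative
        - (\<Sum>k\<in>I. fact (Suc m) * c k ^ Suc (Suc m) / (1 - c k * z) ^ Suc (Suc m))) (at z)"
      by (intro DERIV_minus DERIV_sum)
  qed
  finally show ?case .
qed

lemma max_modulus_cball:
  fixes f :: "complex \<Rightarrow> complex"
  assumes "f holomorphic_on UNIV" "\<And>z. norm z = 1 \<Longrightarrow> norm (f z) \<le> B" "norm z \<le> 1"
  shows "norm (f z) \<le> B"
  using assms
  by (intro maximum_modulus_frontier[of f "cball 0 1" B z])
     (auto intro: holomorphic_on_subset holomorphic_on_imp_continuous_on)

text \<open>On the circle |1 - cnj w * z| = |z - w|, so by the maximum principle \<open>?G\<close> =
  exp \<open>?f\<close> is at most exp H on the disc, that is, Re \<open>?f\<close> <= H there.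
  Borel-Caratheodory bounds \<open>?f\<close> by 2H on the half disc, and Cauchy's inequality at
  radius 1/2 bounds its Taylor coefficients.\<close>

lemma power_sum_bound:
  fixes w :: "'a \<Rightarrow> complex"
  assumes fin: "finite I" and w: "\<And>k. k \<in> I \<Longrightarrow> norm (w k) = 1" and H: "H > 0"
    and bd: "\<And>z. norm z = 1 \<Longrightarrow> norm (\<Prod>k\<in>I. z - w k) \<le> exp H" and m: "m \<ge> 1"
  shows "norm (\<Sum>k\<in>I. w k ^ m) \<le> 2 * H * m * 2 ^ m"
proof -
  let ?G = "\<lambda>z. \<Prod>k\<in>I. 1 - cnj (w k) * z"
  let ?f = "\<lambda>z. \<Sum>k\<in>I. Ln (1 - cnj (w k) * z)"
  have lt1: "norm (cnj (w k) * z) < 1" if "k \<in> I" "norm z < 1" for k z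
    using w[OF that(1)] that(2) by (simp add: norm_mult)
  have pos: "Re (1 - cnj (w k) * z) > 0" if "k \<in> I" "norm z < 1" for k z
    using lt1[OF that] complex_Re_le_cmod[of "cnj (w k) * z"] by simp
  have hol: "?f holomorphic_on ball 0 1"
    using pos by (intro holomorphic_intros) (force simp: complex_nonpos_Reals_iff)
  have Gbd: "norm (?G z) \<le> exp H" if "norm z \<le> 1" for z
  proof (rule max_modulus_cball[of ?G, OF _ _ that])
    fix z :: complex assume z: "norm z = 1"
    have "norm (?G z) = norm (\<Prod>k\<in>I. z - w k)"
      unfolding prod_norm[symmetric]
    proof (rule prod.cong[OF refl])
      fix k assume k: "k \<in> I"
      have "w k * cnj (w k) = 1" using w[OF k] by (simp add: complex_norm_square[symmetric])
      then have "w k * (1 - cnj (w k) * z) = w k - z" by (simp add: algebra_simps)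
      then have "norm (w k * (1 - cnj (w k) * z)) = norm (z - w k)" by (simp add: norm_minus_commute)
      then show "norm (1 - cnj (w k) * z) = norm (z - w k)" using w[OF k] by (simp add: norm_mult)
    qed
    then show "norm (?G z) \<le> exp H" using bd[OF z] by simp
  qed (auto intro!: holomorphic_intros)
  have Re: "Re (?f z) \<le> H" if z: "norm z < 1" for z
  proof -
    have "exp (?f z) = ?G z"
      unfolding exp_sum[OF fin] by (rule prod.cong[OF refl], rule exp_Ln) (metis pos z less_irrefl zero_complex.sel(1))
    then have "exp (Re (?f z)) \<le> exp H"
      using Gbd[of z] z by (metis norm_exp_eq_Re less_imp_le)
    then show ?thesis by simp
  qed
  have f: "norm (?f z) \<le> 2 * H" if "norm z \<le> 1/2" for z
    by (rule borel_caratheodory_half[OF hol _ Re H that]) auto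
  obtain l where l: "m = Suc l" using m by (cases m) auto
  have "norm ((deriv ^^ m) ?f 0) \<le> fact m * (2 * H) / (1/2) ^ m"
  proof (rule Cauchy_inequality)
    show "?f holomorphic_on ball 0 (1/2)" using hol by (rule holomorphic_on_subset) auto
    show "continuous_on (cball 0 (1/2)) ?f"
      by (rule continuous_on_subset[OF holomorphic_on_imp_continuous_on[OF hol]]) auto
  qed (use f in auto)
  \<comment> \<open>With m = l + 1, the factor m of the final bound is the quotient of the m! in
    Cauchy's inequality by the l! in the derivative.\<close>
  also have "(deriv ^^ m) ?f 0 = - (fact l * cnj (\<Sum>k\<in>I. w k ^ m))"
    unfolding l by (subst higher_deriv_sum_Ln) (use w in \<open>auto simp: sum_distrib_left\<close>)
  finally have "fact l * norm (\<Sum>k\<in>I. w k ^ m) \<le> fact l * (2 * H * m * 2 ^ m)"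
    by (simp add: norm_mult l power_divide mult_ac del: cnj_sum)
  then show ?thesis by simp
qed

section \<open>Radial projection of the roots\<close>

text \<open>After expanding the squares, both sides are expressions in \<open>norm x\<close> and
  \<open>inner z x\<close>, because \<open>inner z x\<close> equals \<open>norm x\<close> times
  \<open>inner z (sgn x)\<close>.\<close>

lemma dist_sgn_identity:
  fixes z x :: complex
  assumes z: "norm z = 1" and x: "x \<noteq> 0"
  shows "(norm (z - x))\<^sup>2 = norm x * (norm (z - sgn x))\<^sup>2 + (norm x - 1)\<^sup>2"
proof -
  have 1: "norm z * norm z = 1" using z by simp
  have in_sgn: "norm x * inner z (sgn x) = inner z x"
    using x by (simp add: sgn_div_norm inner_scaleR_right)
  have sg: "inner (sgn x) (sgn x) = 1" using x by (simp add: dot_square_norm norm_sgn)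
  have zz: "inner z z = 1" using z by (simp add: dot_square_norm)
  have xx: "inner x x = norm x * norm x" by (simp add: dot_square_norm power2_eq_square)
  show ?thesis
    unfolding power2_norm_eq_inner using in_sgn
    by (simp add: inner_diff inner_commute sg zz xx power2_eq_square algebra_simps)
qed

text \<open>Projecting the roots to the unit circle (Schur): the factor \<open>1 + \<dots>\<close> measures how far
  a root is from the circle.\<close>
lemma dist_sgn_ge:
  fixes z x :: complex
  assumes z: "norm z = 1" and x: "x \<noteq> 0"
  shows "norm x * ((1 + (norm x - 1)\<^sup>2 / (4 * norm x)) * (norm (z - sgn x))\<^sup>2) \<le> (norm (z - x))\<^sup>2"
proof -
  have "norm (z - sgn x) \<le> 2"
    using norm_triangle_ineq4[of z "sgn x"] z x by (simp add: norm_sgn)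
  then have "(norm (z - sgn x))\<^sup>2 \<le> 2\<^sup>2" by (intro power_mono) auto
  then have "(norm x - 1)\<^sup>2 * (norm (z - sgn x))\<^sup>2 / 4 \<le> (norm x - 1)\<^sup>2"
    using mult_left_mono[of "(norm (z - sgn x))\<^sup>2" 4 "(norm x - 1)\<^sup>2"] by simp
  then show ?thesis unfolding dist_sgn_identity[OF z x] using x by (simp add: field_simps)
qed

text \<open>Multiplying the projection inequality over all roots gives W |Q|^2 <= exp (2H) on the
  circle, where W collects the gains 1 + x k. Since W >= 1, the power sum bound applies to Q. The
  maximum principle at 0 bounds W itself, and W grows geometrically in the number of far
  roots.\<close>

lemma roots_near_circle_and_power_sums:
  fixes r :: "'a \<Rightarrow> complex"
  assumes fin: "finite I" and nz: "\<And>k. k \<in> I \<Longrightarrow> r k \<noteq> 0" and H: "H > 0"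
    and bd: "\<And>z. norm z = 1 \<Longrightarrow> (norm (\<Prod>k\<in>I. z - r k))\<^sup>2 \<le> exp (2 * H) * (\<Prod>k\<in>I. norm (r k))"
  shows "m \<ge> 1 \<Longrightarrow> norm (\<Sum>k\<in>I. sgn (r k) ^ m) \<le> 2 * H * m * 2 ^ m" (is "_ \<Longrightarrow> ?pow")
    and "0 < \<delta> \<Longrightarrow> \<delta> \<le> 1 \<Longrightarrow>
          real (card {k\<in>I. \<bar>norm (r k) - 1\<bar> \<ge> \<delta>}) * ln (1 + \<delta>\<^sup>2 / 8) \<le> 2 * H"
      (is "_ \<Longrightarrow> _ \<Longrightarrow> ?far")
proof -
  define x where "x k = (norm (r k) - 1)\<^sup>2 / (4 * norm (r k))" for k
  define W where "W = (\<Prod>k\<in>I. 1 + x k)"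
  let ?Q = "\<lambda>z. \<Prod>k\<in>I. z - sgn (r k)"
  have x0: "x k \<ge> 0" for k by (simp add: x_def)
  have W1: "W \<ge> 1" unfolding W_def by (intro prod_ge_1) (use x0 in auto)
  have R: "(\<Prod>k\<in>I. norm (r k)) > 0" using nz by (intro prod_pos) auto
  have Q: "W * (norm (?Q z))\<^sup>2 \<le> exp (2 * H)" if z: "norm z = 1" for z
  proof -
    have "(\<Prod>k\<in>I. norm (r k)) * (W * (norm (?Q z))\<^sup>2)
        = (\<Prod>k\<in>I. norm (r k) * ((1 + x k) * (norm (z - sgn (r k)))\<^sup>2))"
      by (simp add: W_def prod.distrib prod_norm[symmetric] prod_power_distrib)
    also have "\<dots> \<le> (\<Prod>k\<in>I. (norm (z - r k))\<^sup>2)"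
      unfolding x_def by (intro prod_mono conjI dist_sgn_ge z nz) (auto intro!: mult_nonneg_nonneg add_nonneg_nonneg)
    also have "\<dots> = (norm (\<Prod>k\<in>I. z - r k))\<^sup>2" by (simp add: prod_norm[symmetric] prod_power_distrib)
    also have "\<dots> \<le> (\<Prod>k\<in>I. norm (r k)) * exp (2 * H)" using bd[OF z] by (simp add: mult.commute)
    finally show ?thesis using R by (simp only: mult_le_cancel_left_pos)
  qed
  show ?pow if "m \<ge> 1"
  proof (rule power_sum_bound[OF fin _ H _ that])
    fix z :: complex assume z: "norm z = 1"
    have "(norm (?Q z))\<^sup>2 \<le> W * (norm (?Q z))\<^sup>2"
      using W1 mult_right_mono[of 1 W "(norm (?Q z))\<^sup>2"] by simp
    also have "\<dots> \<le> (exp H)\<^sup>2" using Q[OF z] by (simp add: exp_double)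
    finally show "norm (?Q z) \<le> exp H" by (rule power2_le_imp_le) simp
  qed (use nz in \<open>simp add: norm_sgn\<close>)
  have "norm (?Q 0) \<le> exp H / sqrt W"
  proof (rule max_modulus_cball[of ?Q])
    fix z :: complex assume z: "norm z = 1"
    have "sqrt (W * (norm (?Q z))\<^sup>2) \<le> sqrt ((exp H)\<^sup>2)"
      using Q[OF z] by (intro real_sqrt_le_mono) (simp add: exp_double)
    then have "sqrt W * norm (?Q z) \<le> exp H" by (simp add: real_sqrt_mult)
    then show "norm (?Q z) \<le> exp H / sqrt W" using W1 by (simp add: field_simps)
  qed (auto intro!: holomorphic_intros)
  \<comment> \<open>All roots of \<open>?Q\<close> have modulus 1, so the bound at the origin turns
    into W <= exp (2H).\<close>
  moreover have "norm (?Q 0) = 1" unfolding prod_norm[symmetric]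
    by (intro prod.neutral) (use nz in \<open>simp add: norm_sgn\<close>)
  ultimately have "sqrt W \<le> exp H" using W1 by (simp add: field_simps)
  then have "(sqrt W)\<^sup>2 \<le> (exp H)\<^sup>2" using W1 by (intro power_mono) auto
  then have WH: "W \<le> exp (2 * H)" using W1 by (simp add: exp_double)
  show ?far if \<delta>: "0 < \<delta>" "\<delta> \<le> 1"
  proof -
    let ?F = "{k\<in>I. \<bar>norm (r k) - 1\<bar> \<ge> \<delta>}"
    have xge: "x k \<ge> \<delta>\<^sup>2 / 8" if k: "k \<in> ?F" for k
    proof -
      let ?t = "norm (r k)"
      have t: "?t > 0" using k nz by auto
      \<comment> \<open>For t <= 2 the distance to the circle suffices. For t > 2 the quotient (t -
        1)^2 / t is at least 1/2, since (2t - 1)(t - 2) >= 0, and \<delta> <= 1 finishes.\<close>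
      have "\<delta>\<^sup>2 * ?t \<le> 2 * (?t - 1)\<^sup>2"
      proof (cases "?t \<le> 2")
        case True
        have "\<delta>\<^sup>2 \<le> (?t - 1)\<^sup>2" using k \<delta> by (simp add: abs_le_square_iff[symmetric])
        then show ?thesis using mult_mono[of "\<delta>\<^sup>2" "(?t-1)\<^sup>2" ?t 2] True t by simp
      next
        case False
        have "\<delta>\<^sup>2 * ?t \<le> 1 * ?t" using \<delta> t by (intro mult_right_mono) (auto simp: power_le_one)
        also have "\<dots> \<le> 2 * (?t - 1)\<^sup>2"
        proof -
          have "0 \<le> (2 * ?t - 1) * (?t - 2)" using False by simp
          then show ?thesis by (simp add: power2_eq_square algebra_simps)
        qed
        finally show ?thesis .
      qed
      then show ?thesis using t unfolding x_def by (simp add: field_simps)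
    qed
    have "(1 + \<delta>\<^sup>2 / 8) ^ card ?F = (\<Prod>k\<in>?F. 1 + \<delta>\<^sup>2 / 8)" by simp
    also have "\<dots> \<le> (\<Prod>k\<in>?F. 1 + x k)" using xge by (intro prod_mono) auto
    also have "\<dots> \<le> W" unfolding W_def
      by (rule prod_mono2[OF fin]) (use x0 in \<open>auto intro: add_nonneg_nonneg\<close>)
    also note WH
    finally have "ln ((1 + \<delta>\<^sup>2 / 8) ^ card ?F) \<le> ln (exp (2 * H))"
      by (subst ln_le_cancel_iff) (auto intro!: zero_less_power add_pos_nonneg)
    then show ?thesis by (simp add: ln_realpow add_pos_nonneg)
  qed
qed

section \<open>From coefficients to roots\<close>

lemma coeff_coeff_poly: "coeff (coeff_poly n a) i = (if i \<le> n then complex_of_real (a i) else 0)"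
  by (auto simp: coeff_poly_def coeff_sum coeff_monom if_distrib cong: if_cong)

lemma poly_coeff_poly: "poly (coeff_poly n a) z = (\<Sum>i\<le>n. complex_of_real (a i) * z ^ i)"
  by (simp add: coeff_poly_def poly_sum poly_monom)

text \<open>On the circle |P| is at most the sum of its n + 1 coefficients, hence at most exp H
  times \<open>a 0\<close> and also exp H times \<open>a n\<close>. The product of the two bounds is
  divided by \<open>a n\<close> squared, using that the moduli of the roots multiply to
  \<open>a 0 / a n\<close>. The term ln (n + 1) in the hypothesis on H counts the
  coefficients.\<close>

lemma coeff_poly_roots:
  assumes roots: "image_mset r (mset_set {1..n}) = proots (coeff_poly n a)"
    and pos: "\<And>i. i \<le> n \<Longrightarrow> 0 < a i" and H: "H > 0"
    and a0: "\<And>i. i \<le> n \<Longrightarrow> a i \<le> exp R * a 0" and an: "\<And>i. i \<le> n \<Longrightarrow> a i \<le> exp R * a n"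
    and RH: "R + ln (real n + 1) \<le> H"
  shows "\<And>k. k \<in> {1..n} \<Longrightarrow> r k \<noteq> 0"
    and "\<And>z. norm z = 1 \<Longrightarrow>
           (norm (\<Prod>k=1..n. z - r k))\<^sup>2 \<le> exp (2 * H) * (\<Prod>k=1..n. norm (r k))"
proof -
  let ?p = "coeff_poly n a"
  have p0: "?p \<noteq> 0"
    using pos[of n] coeff_coeff_poly[of n a n] by auto
  have "degree ?p \<le> n" by (rule degree_le) (simp add: coeff_coeff_poly)
  moreover have "n \<le> degree ?p" using pos[of n] by (intro le_degree) (simp add: coeff_coeff_poly)
  ultimately have deg: "degree ?p = n" by simp
  have fac: "poly ?p z = complex_of_real (a n) * (\<Prod>k=1..n. z - r k)" for z
  proof -
    have "poly ?p z = poly (smult (lead_coeff ?p) (\<Prod>x\<in>#proots ?p. [:-x, 1:])) z"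
      by (simp only: complex_poly_decompose_multiset)
    also have "\<dots> = complex_of_real (a n) * (\<Prod>k=1..n. z - r k)"
      by (simp add: deg coeff_coeff_poly roots[symmetric] poly_prod_mset image_mset.compositionality
            o_def prod_unfold_prod_mset)
    finally show ?thesis .
  qed
  have poly0: "poly ?p 0 = complex_of_real (a 0)" by (simp add: poly_coeff_poly power_0_left if_distrib cong: if_cong)
  have prodr: "a n * (\<Prod>k=1..n. norm (r k)) = a 0"
  proof -
    have "norm (poly ?p 0) = a n * (\<Prod>k=1..n. norm (r k))"
      unfolding fac using pos[of n] by (simp add: norm_mult prod_norm[symmetric])
    then show ?thesis using pos[of 0] by (simp add: poly0)
  qed
  show "r k \<noteq> 0" if "k \<in> {1..n}" for k
  proof
    assume "r k = 0"
    with that have "(\<Prod>k=1..n. norm (r k)) = 0" by (intro prod_zero) auto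
    then have "a 0 = 0" unfolding prodr[symmetric] by (simp only: mult_zero_right)
    with pos[of 0] show False by simp
  qed
  show "(norm (\<Prod>k=1..n. z - r k))\<^sup>2 \<le> exp (2 * H) * (\<Prod>k=1..n. norm (r k))" if z: "norm z = 1" for z
  proof -
    have "norm (poly ?p z) \<le> (\<Sum>i\<le>n. a i)"
      unfolding poly_coeff_poly
      by (rule order.trans[OF norm_sum]) (use pos z in \<open>simp add: norm_mult norm_power less_imp_le\<close>)
    also have "\<dots> \<le> exp H * b" if "\<And>i. i \<le> n \<Longrightarrow> a i \<le> exp R * b" "b > 0" for b
    proof -
      have "(\<Sum>i\<le>n. a i) \<le> (\<Sum>i\<le>n. exp R * b)" using that by (intro sum_mono) auto
      also have "\<dots> = exp (R + ln (real n + 1)) * b" by (simp add: exp_add algebra_simps)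
      also have "\<dots> \<le> exp H * b" using RH that by (intro mult_right_mono) auto
      finally show ?thesis .
    qed
    finally have "norm (poly ?p z) \<le> exp H * a 0" "norm (poly ?p z) \<le> exp H * a n"
      using a0 an pos by auto
    then have "norm (poly ?p z) * norm (poly ?p z) \<le> (exp H * a n) * (exp H * a 0)"
      by (intro mult_mono) (use pos[of n] in auto)
    also have "\<dots> = a n * a n * (exp (2 * H) * (\<Prod>k=1..n. norm (r k)))"
      unfolding prodr[symmetric] by (simp add: exp_double power2_eq_square)
    finally have "a n * a n * (norm (\<Prod>k=1..n. z - r k))\<^sup>2
        \<le> a n * a n * (exp (2 * H) * (\<Prod>k=1..n. norm (r k)))"
      unfolding fac using pos[of n] by (simp add: norm_mult power2_eq_square mult_ac)
    then show ?thesis using pos[of n] by simp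
  qed
qed

section \<open>Weyl equidistribution and the Levy--Prokhorov metric\<close>

lemma borel_measurable_cis [measurable]: "cis \<in> borel_measurable borel"
  by (intro borel_measurable_continuous_onI continuous_intros)

lemma borel_measurable_cnj [measurable]: "cnj \<in> borel_measurable borel"
  by (intro borel_measurable_continuous_onI continuous_intros)

lemma prob_space_uniform_circle: "prob_space uniform_circle"
  unfolding uniform_circle_def
  by (rule prob_space.prob_space_distr, rule prob_space_uniform_measure) simp_all

lemma sets_uniform_circle [simp, measurable_cong]: "sets uniform_circle = sets borel"
  by (simp add: uniform_circle_def)

lemma AE_uniform_circle: "AE z in uniform_circle. norm z = 1"
  unfolding uniform_circle_def by (subst AE_distr_iff) simp_all

text \<open>The function may be unbounded on the plane, but it is bounded on the compact unit
  circle, which carries all the mass.\<close>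

lemma integrable_uniform_circle:
  fixes f :: "complex \<Rightarrow> 'b::{banach, second_countable_topology}"
  assumes "continuous_on UNIV f"
  shows "integrable uniform_circle f"
proof -
  interpret prob_space uniform_circle by (rule prob_space_uniform_circle)
  have "compact (f ` sphere 0 1)"
    by (intro compact_continuous_image continuous_on_subset[OF assms]) auto
  then obtain B where "\<forall>x\<in>sphere 0 1. norm (f x) \<le> B"
    by (auto dest!: compact_imp_bounded simp: bounded_iff simp del: mem_sphere)
  then have "norm (f z) \<le> B" if "norm z = 1" for z using that by auto
  then have "AE z in uniform_circle. norm (f z) \<le> B" using AE_uniform_circle by auto
  moreover have "f \<in> borel_measurable uniform_circle"
    using borel_measurable_continuous_onI[OF assms] by simp
  ultimately show ?thesis by (rule integrable_const_bound)
qed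

lemma integral_uniform_circle_power:
  assumes "m \<ge> 1"
  shows "(\<integral>z. z ^ m \<partial>uniform_circle) = 0"
proof -
  have "emeasure lborel {0..<2 * pi} = ennreal (2 * pi)" by simp
  then have *: "uniform_measure lborel {0..<2 * pi}
      = density lborel (\<lambda>x. ennreal (indicator {0..<2 * pi} x / (2 * pi)))"
    unfolding uniform_measure_def by (intro density_cong) (auto simp: indicator_def divide_ennreal[symmetric])
  have "(\<integral>z. z ^ m \<partial>uniform_circle) = (\<integral>x. (indicator {0..<2 * pi} x / (2 * pi)) *\<^sub>R cis x ^ m \<partial>lborel)"
    unfolding uniform_circle_def * by (subst integral_distr) (simp_all add: integral_density)
  \<comment> \<open>Adding the null point 2 pi gives the closed interval on which the fundamental
    theorem of calculus is applied; the antiderivative takes equal values at both ends.\<close>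
  also have "\<dots> = (\<integral>x. indicator {0..2 * pi} x *\<^sub>R ((1 / (2 * pi)) *\<^sub>R cis (real m * x)) \<partial>lborel)"
  proof (rule integral_cong_AE)
    show "AE x in lborel. (indicator {0..<2 * pi} x / (2 * pi)) *\<^sub>R cis x ^ m
        = indicator {0..2 * pi} x *\<^sub>R ((1 / (2 * pi)) *\<^sub>R cis (real m * x))"
      using AE_lborel_singleton[of "2 * pi"]
      by eventually_elim (auto simp: indicator_def Complex.DeMoivre)
  qed auto
  also have "\<dots> = cis (real m * (2 * pi)) / (2 * pi * \<i> * m) - cis (real m * 0) / (2 * pi * \<i> * m)"
  proof (rule has_bochner_integral_integral_eq, rule has_bochner_integral_FTC_Icc)
    fix x :: real
    have "((\<lambda>z. exp (\<i> * (of_nat m * z)) / (2 * pi * \<i> * m)) has_field_derivative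
            exp (\<i> * (of_nat m * of_real x)) / (2 * pi)) (at (of_real x))"
      using assms by (auto intro!: derivative_eq_intros simp: field_simps)
    from has_vector_derivative_real_field[OF this]
    show "((\<lambda>x. cis (real m * x) / (2 * pi * \<i> * m)) has_vector_derivative
            (1 / (2 * pi)) *\<^sub>R cis (real m * x)) (at x within {0..2 * pi})"
      by (simp add: cis_conv_exp scaleR_conv_of_real)
  qed (auto intro!: continuous_intros)
  also have "cis (real m * (2 * pi)) = 1" using cis_multiple_2pi[of "real m"] by (simp add: mult_ac)
  finally show ?thesis by simp
qed

section \<open>Laurent polynomials and Weyl's criterion\<close>

text \<open>On the circle \<open>cnj z\<close> = 1 / z, so the real and imaginary parts are Laurent
  polynomials in z, and so is everything built from them. This links the Stone-Weierstrass
  approximants to power sums.\<close>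

lemma real_polynomial_function_on_circle:
  fixes p :: "complex \<Rightarrow> real"
  assumes "real_polynomial_function p"
  shows "\<exists>q N. \<forall>z. norm z = 1 \<longrightarrow> complex_of_real (p z) = poly q z / z ^ N"
  using assms
proof (induction rule: real_polynomial_function.induct)
  case (linear f)
  define a b where "a = complex_of_real (f 1)" and "b = complex_of_real (f \<i>)"
  \<comment> \<open>A real-linear f is determined by f 1 and f \<i>; the coefficients come from Re z
    = (z + 1/z) / 2 and Im z = -(\<i>/2) (z - 1/z).\<close>
  have "complex_of_real (f z) = poly [:(a + \<i> * b) / 2, 0, (a - \<i> * b) / 2:] z / z ^ 1"
    if z: "norm z = 1" for z
  proof -
    interpret bounded_linear f by (rule linear)
    have zc: "z * cnj z = 1" using z by (simp add: complex_norm_square[symmetric])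
    have "z = Re z *\<^sub>R 1 + Im z *\<^sub>R \<i>" by (simp add: complex_eq_iff)
    then have "f z = Re z * f 1 + Im z * f \<i>" by (metis add scaleR real_scaleR_def)
    then have "complex_of_real (f z) = complex_of_real (Re z) * a + complex_of_real (Im z) * b"
      by (simp add: a_def b_def)
    also have "\<dots> = (z + cnj z) / 2 * a + (- (\<i> / 2) * (z - cnj z)) * b"
      by (intro arg_cong2[where f = "(+)"] arg_cong2[where f = "(*)"] refl) (simp_all add: complex_eq_iff)
    also have "cnj z = 1 / z" using zc z by (metis mult.commute nonzero_eq_divide_eq norm_zero zero_neq_one)
    also have "(z + 1 / z) / 2 * a + (- (\<i> / 2) * (z - 1 / z)) * b
        = poly [:(a + \<i> * b) / 2, 0, (a - \<i> * b) / 2:] z / z ^ 1"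
    proof -
      have "z \<noteq> 0" using z by auto
      then show ?thesis by (simp add: divide_simps) (simp add: algebra_simps)
    qed
    finally show ?thesis .
  qed
  then show ?case by blast
next
  case (const c)
  have "complex_of_real c = poly [:complex_of_real c:] z / z ^ 0" for z by simp
  then show ?case by blast
next
  case (add f g)
  then obtain q N q' N' where q:
    "\<forall>z. norm z = 1 \<longrightarrow> complex_of_real (f z) = poly q z / z ^ N"
    "\<forall>z. norm z = 1 \<longrightarrow> complex_of_real (g z) = poly q' z / z ^ N'" by blast
  then have "complex_of_real (f z + g z) = poly (q * monom 1 N' + q' * monom 1 N) z / z ^ (N + N')"
    if z: "norm z = 1" for z
  proof -
    have "z \<noteq> 0" using z by auto
    with q z
    show ?thesis by (simp add: poly_monom field_simps power_add)
  qed
  then show ?case by blast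
next
  case (mult f g)
  then obtain q N q' N' where
    "\<forall>z. norm z = 1 \<longrightarrow> complex_of_real (f z) = poly q z / z ^ N"
    "\<forall>z. norm z = 1 \<longrightarrow> complex_of_real (g z) = poly q' z / z ^ N'" by blast
  then have "complex_of_real (f z * g z) = poly (q * q') z / z ^ (N + N')"
    if "norm z = 1" for z
    using that by (auto simp: power_add)
  then show ?case by blast
qed

text \<open>On the circle negative powers are conjugates of positive ones. The right-hand side is
  continuous on the whole plane, while the left-hand side may have a pole at 0.\<close>

lemma laurent_monomial_on_circle:
  fixes z :: complex
  assumes "norm z = 1"
  shows "z ^ i / z ^ N = (if N \<le> i then z ^ (i - N) else cnj (z ^ (N - i)))"
proof -
  have z0: "z \<noteq> 0" using assms by auto
  have zc: "z * cnj z = 1" using assms by (simp add: complex_norm_square[symmetric])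
  have "cnj z = inverse z" using zc z0 by (auto simp: field_simps)
  then have "cnj z ^ d * z ^ d = 1" for d using z0 by (simp add: power_mult_distrib[symmetric])
  then have "z ^ i / z ^ (i + d) = cnj z ^ d" for d using z0 by (simp add: power_add field_simps)
  then have "z ^ i / z ^ N = cnj z ^ (N - i)" if "i \<le> N" using that by (metis le_add_diff_inverse)
  then show ?thesis using z0 by (simp add: power_diff)
qed

text \<open>The power sum hypothesis and its conjugate settle all Laurent monomials other than the
  constant 1, which is trivial. Linearity extends this to real polynomial functions, and
  Stone-Weierstrass on the circle to continuous ones.\<close>

lemma weyl_equidistribution:
  fixes w :: "nat \<Rightarrow> nat \<Rightarrow> complex" and g :: "complex \<Rightarrow> real"
  assumes w: "\<forall>\<^sub>F n in sequentially. \<forall>k\<in>{1..n}. norm (w n k) = 1"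
    and pow: "\<And>m. m \<ge> 1 \<Longrightarrow> (\<lambda>n. (\<Sum>k=1..n. w n k ^ m) / n) \<longlonglongrightarrow> 0"
    and g: "continuous_on UNIV g"
  shows "(\<lambda>n. (\<Sum>k=1..n. g (w n k)) / n) \<longlonglongrightarrow> (\<integral>z. g z \<partial>uniform_circle)"
proof -
  interpret U: prob_space uniform_circle by (rule prob_space_uniform_circle)
  have mono_lim: "(\<lambda>n. (\<Sum>k=1..n. w n k ^ i / w n k ^ N) / n) \<longlonglongrightarrow> (\<integral>z. z ^ i / z ^ N \<partial>uniform_circle)"
    for i N
  proof -
    let ?h = "\<lambda>z::complex. if N \<le> i then z ^ (i - N) else cnj (z ^ (N - i))"
    have "AE z in uniform_circle. z ^ i / z ^ N = ?h z"
      using AE_uniform_circle by eventually_elim (rule laurent_monomial_on_circle)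
    moreover have "?h \<in> borel_measurable uniform_circle"
      by (cases "N \<le> i") (simp_all del: complex_cnj_power)
    ultimately have int_eq: "(\<integral>z. z ^ i / z ^ N \<partial>uniform_circle) = (\<integral>z. ?h z \<partial>uniform_circle)"
      by (intro integral_cong_AE) simp_all
    have h_lim: "(\<lambda>n. (\<Sum>k=1..n. ?h (w n k)) / n) \<longlonglongrightarrow> (\<integral>z. ?h z \<partial>uniform_circle)"
    proof (cases "i = N")
      case True
      have "\<forall>\<^sub>F n in sequentially. (\<Sum>k=1..n. ?h (w n k)) / n = 1"
        using eventually_gt_at_top[of 0] by eventually_elim (simp add: True)
      then show ?thesis by (simp add: True tendsto_eventually U.prob_space)
    next
      case False
      show ?thesis
      proof (cases "N \<le> i")
        case True
        with False pow[of "i - N"] integral_uniform_circle_power[of "i - N"] show ?thesis by simp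
      next
        case False
        have "(\<lambda>n. cnj ((\<Sum>k=1..n. w n k ^ (N - i)) / n)) \<longlonglongrightarrow> cnj 0"
          using False by (intro tendsto_cnj pow) auto
        moreover have "(\<integral>z. cnj (z ^ (N - i)) \<partial>uniform_circle) = cnj (\<integral>z. z ^ (N - i) \<partial>uniform_circle)"
          by (rule Bochner_Integration.integral_cnj)
        ultimately show ?thesis
          using False integral_uniform_circle_power[of "N - i"] by simp
      qed
    qed
    have "\<forall>\<^sub>F n in sequentially.
        (\<Sum>k=1..n. ?h (w n k)) / n = (\<Sum>k=1..n. w n k ^ i / w n k ^ N) / n"
      using w
    proof eventually_elim
      case (elim n)
      then have "(\<Sum>k=1..n. ?h (w n k)) = (\<Sum>k=1..n. w n k ^ i / w n k ^ N)"
        by (intro sum.cong refl) (simp add: laurent_monomial_on_circle)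
      then show ?case by simp
    qed
    with h_lim show ?thesis unfolding int_eq by (rule Lim_transform_eventually)
  qed
  have poly_lim: "(\<lambda>n. (\<Sum>k=1..n. p (w n k)) / n) \<longlonglongrightarrow> (\<integral>z. p z \<partial>uniform_circle)"
    if p: "real_polynomial_function p" for p :: "complex \<Rightarrow> real"
  proof -
    obtain q N where q: "\<And>z. norm z = 1 \<Longrightarrow> complex_of_real (p z) = poly q z / z ^ N"
      using real_polynomial_function_on_circle[OF p] by blast
    have q': "poly q z / z ^ N = (\<Sum>i\<le>degree q. coeff q i * (z ^ i / z ^ N))" for z
      by (simp add: poly_altdef sum_divide_distrib)
    have int: "integrable uniform_circle (\<lambda>z. z ^ i / z ^ N)" for i
    proof (rule Bochner_Integration.integrable_cong_AE_imp)
      show "integrable uniform_circle (\<lambda>z. if N \<le> i then z ^ (i - N) else cnj (z ^ (N - i)))"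
        by (intro integrable_uniform_circle, cases "N \<le> i") (auto intro!: continuous_intros)
      show "AE z in uniform_circle. (if N \<le> i then z ^ (i - N) else cnj (z ^ (N - i))) = z ^ i / z ^ N"
        using AE_uniform_circle by eventually_elim (rule laurent_monomial_on_circle[symmetric])
    qed simp
    have "(\<lambda>n. \<Sum>i\<le>degree q. coeff q i * ((\<Sum>k=1..n. w n k ^ i / w n k ^ N) / n))
        \<longlonglongrightarrow> (\<Sum>i\<le>degree q. coeff q i * (\<integral>z. z ^ i / z ^ N \<partial>uniform_circle))"
      by (intro tendsto_intros mono_lim)
    also have "(\<Sum>i\<le>degree q. coeff q i * (\<integral>z. z ^ i / z ^ N \<partial>uniform_circle))
        = (\<integral>z. (\<Sum>i\<le>degree q. coeff q i * (z ^ i / z ^ N)) \<partial>uniform_circle)"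
      using int by (subst Bochner_Integration.integral_sum) (auto simp del: times_divide_eq_right)
    also have "\<dots> = (\<integral>z. complex_of_real (p z) \<partial>uniform_circle)"
      unfolding q'[symmetric]
    proof (rule integral_cong_AE)
      have "continuous_on UNIV p" using p by (simp add: continuous_on_polymonial_function real_polynomial_function_eq)
      then have [measurable]: "p \<in> borel_measurable borel" by (rule borel_measurable_continuous_onI)
      show "(\<lambda>z. complex_of_real (p z)) \<in> borel_measurable uniform_circle" by measurable
      have [measurable]: "poly q \<in> borel_measurable borel"
        by (intro borel_measurable_continuous_onI continuous_intros)
      show "(\<lambda>z. poly q z / z ^ N) \<in> borel_measurable uniform_circle" by measurable
      show "AE z in uniform_circle. poly q z / z ^ N = complex_of_real (p z)"
        using AE_uniform_circle by eventually_elim (simp add: q)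
    qed
    also have "\<dots> = complex_of_real (\<integral>z. p z \<partial>uniform_circle)" by (rule integral_complex_of_real)
    finally have lim: "(\<lambda>n. \<Sum>i\<le>degree q. coeff q i * ((\<Sum>k=1..n. w n k ^ i / w n k ^ N) / n))
      \<longlonglongrightarrow> complex_of_real (\<integral>z. p z \<partial>uniform_circle)" .
    have "\<forall>\<^sub>F n in sequentially.
        (\<Sum>i\<le>degree q. coeff q i * ((\<Sum>k=1..n. w n k ^ i / w n k ^ N) / n))
        = complex_of_real ((\<Sum>k=1..n. p (w n k)) / n)"
      using w
    proof eventually_elim
      case (elim n)
      have "complex_of_real (\<Sum>k=1..n. p (w n k)) = (\<Sum>k=1..n. poly q (w n k) / w n k ^ N)"
        using elim by (simp add: q)
      also have "\<dots> = (\<Sum>i\<le>degree q. coeff q i * (\<Sum>k=1..n. w n k ^ i / w n k ^ N))"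
        unfolding q' sum_distrib_left by (rule sum.swap)
      finally show ?case
        by (simp only: times_divide_eq_right sum_divide_distrib[symmetric] of_real_divide of_real_of_nat_eq)
    qed
    with lim have "(\<lambda>n. complex_of_real ((\<Sum>k=1..n. p (w n k)) / n))
        \<longlonglongrightarrow> complex_of_real (\<integral>z. p z \<partial>uniform_circle)"
      by (rule Lim_transform_eventually)
    then show ?thesis by (simp only: tendsto_of_real_iff)
  qed
  show ?thesis
  proof (rule tendstoI)
    fix e :: real assume e: "e > 0"
    \<comment> \<open>The three thirds pay for replacing g by p in the average, for the convergence
      of the average of p, and for replacing p by g in the integral.\<close>
    then have e3: "e / 3 > 0" by simp
    obtain p where p: "real_polynomial_function p"
      and pg: "\<And>z. z \<in> sphere 0 1 \<Longrightarrow> \<bar>g z - p z\<bar> < e / 3"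
      using Stone_Weierstrass_real_polynomial_function[of "sphere (0::complex) 1" g "e / 3"] g e
      by (metis compact_sphere continuous_on_subset divide_pos_pos subset_UNIV zero_less_numeral)
    have contp: "continuous_on UNIV p"
      using p by (simp add: continuous_on_polymonial_function real_polynomial_function_eq)
    have int: "\<bar>(\<integral>z. g z \<partial>uniform_circle) - (\<integral>z. p z \<partial>uniform_circle)\<bar> \<le> e / 3"
    proof -
      have "\<bar>(\<integral>z. g z - p z \<partial>uniform_circle)\<bar> \<le> (\<integral>z. \<bar>g z - p z\<bar> \<partial>uniform_circle)"
        by (rule integral_abs_bound)
      also have "\<dots> \<le> (\<integral>z. e / 3 \<partial>uniform_circle)"
      proof (rule integral_mono_AE)
        show "AE z in uniform_circle. \<bar>g z - p z\<bar> \<le> e / 3"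
          using AE_uniform_circle by eventually_elim (use pg in \<open>auto intro: less_imp_le\<close>)
      qed (auto intro!: integrable_uniform_circle continuous_intros g contp)
      finally show ?thesis
        by (simp add: U.prob_space integrable_uniform_circle g contp)
    qed
    show "\<forall>\<^sub>F n in sequentially. dist ((\<Sum>k=1..n. g (w n k)) / n) (\<integral>z. g z \<partial>uniform_circle) < e"
      using w eventually_gt_at_top[of 0] tendstoD[OF poly_lim[OF p] e3]
    proof eventually_elim
      case (elim n)
      have "\<bar>(\<Sum>k=1..n. g (w n k)) - (\<Sum>k=1..n. p (w n k))\<bar> \<le> (\<Sum>k=1..n. \<bar>g (w n k) - p (w n k)\<bar>)"
        unfolding sum_subtractf[symmetric] by (rule sum_abs)
      also have "\<dots> \<le> (\<Sum>k=1..n. e / 3)" using elim(1) by (intro sum_mono less_imp_le pg) auto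
      finally have "\<bar>(\<Sum>k=1..n. g (w n k)) / n - (\<Sum>k=1..n. p (w n k)) / n\<bar> \<le> e / 3"
        using elim(2) by (simp add: diff_divide_distrib[symmetric] field_simps)
      with int elim(3) show ?case unfolding dist_real_def by linarith
    qed
  qed
qed

section \<open>Levy-Prokhorov convergence of empirical measures\<close>

lemma measure_empirical_measure:
  assumes "A \<in> sets borel"
  shows "measure (empirical_measure n z) A = card {k\<in>{1..n}. z k \<in> A} / n"
proof -
  have "z \<in> uniform_count_measure {1..n} \<rightarrow>\<^sub>M borel"
    by (auto simp: measurable_def sets_uniform_count_measure space_uniform_count_measure)
  then have "measure (empirical_measure n z) A = measure (uniform_count_measure {1..n}) (z -` A \<inter> {1..n})"
    unfolding empirical_measure_def using assms by (simp add: measure_distr space_uniform_count_measure)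
  also have "z -` A \<inter> {1..n} = {k\<in>{1..n}. z k \<in> A}" by auto
  also have "measure (uniform_count_measure {1..n}) \<dots> = card {k\<in>{1..n}. z k \<in> A} / card {1..n}"
    by (rule measure_uniform_count_measure) auto
  finally show ?thesis by simp
qed

text \<open>Levy--Prokhorov closeness only has to be tested on the finitely many continuous functions
  attached to the subsets of a finite net of the circle.\<close>
lemma levy_prokhorov_empirical_tendsto:
  fixes z :: "nat \<Rightarrow> nat \<Rightarrow> complex"
  assumes nz: "\<forall>\<^sub>F n in sequentially. \<forall>k\<in>{1..n}. z n k \<noteq> 0"
    and far: "\<And>\<delta>. 0 < \<delta> \<Longrightarrow> \<delta> \<le> 1 \<Longrightarrow> (\<lambda>n. card {k\<in>{1..n}. \<bar>norm (z n k) - 1\<bar> \<ge> \<delta>} / n) \<longlonglongrightarrow> 0"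
    and avg: "\<And>g :: complex \<Rightarrow> real. continuous_on UNIV g \<Longrightarrow>
           (\<lambda>n. (\<Sum>k=1..n. g (sgn (z n k))) / n) \<longlonglongrightarrow> (\<integral>x. g x \<partial>uniform_circle)"
  shows "(\<lambda>n. levy_prokhorov (empirical_measure n (z n)) uniform_circle) \<longlonglongrightarrow> 0"
proof (rule tendstoI)
  interpret U: prob_space uniform_circle by (rule prob_space_uniform_circle)
  have Usp: "space uniform_circle = UNIV" by (simp add: uniform_circle_def)
  have int_ind: "integrable uniform_circle (indicator A :: _ \<Rightarrow> real)" if "A \<in> sets borel" for A
    by (rule integrable_real_indicator) (use that in \<open>simp_all add: U.emeasure_eq_measure\<close>)
  fix e0 :: real assume e0: "e0 > 0"
  define e where "e = e0 / 2"
  \<comment> \<open>Five steps of size \<delta> must fit into e: the cutoff functions below reach up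
    to 4\<delta> beyond the set under test, and a near root lies within \<delta> of its projection.
    Halving \<open>e0\<close> makes the final inequality strict.\<close>
  define \<delta> where "\<delta> = min 1 (e / 5)"
  have e: "e > 0" and \<delta>: "\<delta> > 0" "\<delta> \<le> 1" "5 * \<delta> \<le> e" using e0 by (auto simp: \<delta>_def e_def)
  obtain T where T: "finite T" "sphere (0::complex) 1 \<subseteq> (\<Union>p\<in>T. ball p \<delta>)"
  proof -
    have "\<forall>e>0. \<exists>T. finite T \<and> sphere (0::complex) 1 \<subseteq> (\<Union>p\<in>T. ball p e)"
      using compact_sphere[of "0::complex" 1] unfolding compact_eq_totally_bounded by (rule conjunct2)
    then show ?thesis using that \<delta>(1) by meson
  qed
  \<comment> \<open>A continuous cutoff: for F inside T it equals 1 within \<delta> of F, and it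
    vanishes at distance 2\<delta> or more from F.\<close>
  define g where "g F x = min 1 (\<Sum>p\<in>F. max 0 (2 - dist x p / \<delta>))" for F and x :: complex
  have g_cont: "continuous_on UNIV (g F)" for F
    unfolding g_def using \<delta> by (intro continuous_intros) auto
  have g0: "0 \<le> g F x" and g1: "g F x \<le> 1" for F x
    unfolding g_def by (auto intro!: sum_nonneg)
  have g_eq1: "g F x = 1" if "p \<in> F" "F \<subseteq> T" "dist x p \<le> \<delta>" for F x p
  proof -
    have "1 \<le> max 0 (2 - dist x p / \<delta>)" using that \<delta> by (simp add: field_simps)
    also have "\<dots> \<le> (\<Sum>p\<in>F. max 0 (2 - dist x p / \<delta>))"
      by (rule member_le_sum) (use that T finite_subset in auto)
    finally show ?thesis by (simp add: g_def)
  qed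
  have g_pos: "\<exists>p\<in>F. dist x p < 2 * \<delta>" if "g F x \<noteq> 0" for F x
  proof (rule ccontr)
    assume "\<not> ?thesis"
    then have "(\<Sum>p\<in>F. max 0 (2 - dist x p / \<delta>)) = 0"
      using \<delta> by (intro sum.neutral) (auto simp: field_simps not_less)
    with that show False by (simp add: g_def)
  qed
  \<comment> \<open>T has finitely many subsets, so one threshold for n serves all of them and
    thereby every Borel set A at once.\<close>
  have "\<forall>\<^sub>F n in sequentially. \<forall>F\<in>Pow T.
      dist ((\<Sum>k=1..n. g F (sgn (z n k))) / n) (\<integral>x. g F x \<partial>uniform_circle) < \<delta>"
    using T \<delta>(1) by (intro eventually_ball_finite ballI tendstoD[OF avg[OF g_cont]]) simp_all
  moreover have "\<forall>\<^sub>F n in sequentially. dist (card {k\<in>{1..n}. \<bar>norm (z n k) - 1\<bar> \<ge> \<delta>} / real n) 0 < \<delta>"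
    by (rule tendstoD[OF far]) (use \<delta> in auto)
  ultimately show "\<forall>\<^sub>F n in sequentially.
      dist (levy_prokhorov (empirical_measure n (z n)) uniform_circle) 0 < e0"
    using nz eventually_gt_at_top[of 0]
  proof eventually_elim
    case (elim n)
    let ?\<mu> = "empirical_measure n (z n)"
    let ?far = "{k\<in>{1..n}. \<bar>norm (z n k) - 1\<bar> \<ge> \<delta>}"
    let ?w = "\<lambda>k. sgn (z n k)"
    have n: "real n > 0" using elim by simp
    have near: "dist (?w k) (z n k) < \<delta>" if "k \<in> {1..n} - ?far" for k
    proof -
      have "z n k \<noteq> 0" using elim(3) that by auto
      then have "z n k = norm (z n k) *\<^sub>R ?w k" by (simp add: sgn_div_norm)
      then have "?w k - z n k = (1 - norm (z n k)) *\<^sub>R ?w k" by (metis scaleR_left_diff_distrib scaleR_one)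
      then have "dist (?w k) (z n k) = \<bar>1 - norm (z n k)\<bar>"
        using \<open>z n k \<noteq> 0\<close> by (simp add: dist_norm norm_sgn)
      then show ?thesis using that by auto
    qed
    have main: "measure ?\<mu> A \<le> measure uniform_circle (\<Union>x\<in>A. ball x e) + e \<and>
        measure uniform_circle A \<le> measure ?\<mu> (\<Union>x\<in>A. ball x e) + e" if A: "A \<in> sets borel" for A
    proof -
      \<comment> \<open>The net points near A: \<open>g F\<close> is 1 at every circle point within
        \<delta> of A and is supported within 4\<delta> of A, so it sits between the indicators of A
        and of its e-neighbourhood on the circle.\<close>
      define F where "F = {p\<in>T. \<exists>a\<in>A. dist p a < 2 * \<delta>}"
      let ?B = "\<Union>x\<in>A. ball x e"
      have B: "?B \<in> sets borel" by (intro borel_open) auto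
      have FT: "F \<subseteq> T" by (auto simp: F_def)
      have avgF: "\<bar>(\<Sum>k=1..n. g F (?w k)) / n - (\<integral>x. g F x \<partial>uniform_circle)\<bar> < \<delta>"
        using elim(1) FT by (auto simp: dist_real_def)
      have farF: "card ?far / n < \<delta>" using elim(2) by simp
      have gA: "g F x = 1" if x: "norm x = 1" and a: "a \<in> A" "dist x a < \<delta>" for x a
      proof -
        obtain p where p: "p \<in> T" "dist p x < \<delta>" using T x by auto
        have "dist p a < 2 * \<delta>" using dist_triangle[of p a x] p a by simp
        then have "p \<in> F" using p a by (auto simp: F_def)
        then show ?thesis using g_eq1[OF _ FT, of p x] p by (simp add: dist_commute)
      qed
      have gB: "\<exists>a\<in>A. dist x a < 4 * \<delta>" if gx: "g F x \<noteq> 0" for x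
      proof -
        obtain p a where "dist x p < 2 * \<delta>" "a \<in> A" "dist p a < 2 * \<delta>"
          using g_pos[OF gx] unfolding F_def by blast
        then show ?thesis using dist_triangle[of x a p] by (intro bexI[of _ a]) auto
      qed
      have "measure ?\<mu> A \<le> measure uniform_circle ?B + e"
      proof -
        have "real (card {k\<in>{1..n}. z n k \<in> A}) = (\<Sum>k=1..n. if z n k \<in> A then 1 else 0)"
          by (simp add: sum.If_cases Int_def)
        also have "\<dots> \<le> (\<Sum>k=1..n. (if k \<in> ?far then 1 else 0) + g F (?w k))"
        proof (rule sum_mono)
          fix k assume k: "k \<in> {1..n}"
          have "g F (?w k) = 1" if "k \<notin> ?far" "z n k \<in> A"
            using elim(3) k that near[of k] by (intro gA[of _ "z n k"]) (auto simp: norm_sgn)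
          then show "(if z n k \<in> A then 1 else 0) \<le> (if k \<in> ?far then 1 else 0) + g F (?w k)"
            using g0[of F "?w k"] by auto
        qed
        also have "\<dots> = card ?far + (\<Sum>k=1..n. g F (?w k))"
          by (simp add: sum.distrib sum.If_cases Int_def)
        finally have "measure ?\<mu> A \<le> card ?far / n + (\<Sum>k=1..n. g F (?w k)) / n"
          using n A by (simp add: measure_empirical_measure field_simps)
        also have "(\<Sum>k=1..n. g F (?w k)) / n \<le> (\<integral>x. g F x \<partial>uniform_circle) + \<delta>" using avgF by simp
        also have "(\<integral>x. g F x \<partial>uniform_circle) \<le> (\<integral>x. indicator ?B x \<partial>uniform_circle)"
        proof (rule integral_mono)
          fix x
          show "g F x \<le> indicator ?B x"
          proof (cases "g F x = 0")
            case False
            then obtain a where "a \<in> A" "dist x a < 4 * \<delta>" using gB by blast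
            moreover have "4 * \<delta> \<le> e" using \<delta> by simp
            ultimately have "x \<in> ?B" by (force simp: dist_commute)
            then show ?thesis using g1[of F x] by simp
          qed simp
        qed (rule integrable_uniform_circle[OF g_cont], rule int_ind[OF B])
        also have "(\<integral>x. indicator ?B x \<partial>uniform_circle) = measure uniform_circle ?B"
          by (simp add: Usp)
        finally show ?thesis using farF \<delta> by linarith
      qed
      moreover have "measure uniform_circle A \<le> measure ?\<mu> ?B + e"
      proof -
        have "measure uniform_circle A = (\<integral>x. indicator A x \<partial>uniform_circle)" by (simp add: Usp)
        also have "\<dots> \<le> (\<integral>x. g F x \<partial>uniform_circle)"
        proof (rule integral_mono_AE)
          show "AE x in uniform_circle. indicator A x \<le> g F x"
            using AE_uniform_circle
            by eventually_elim (use gA \<delta> g0 in \<open>auto simp: indicator_def\<close>)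
        qed (rule int_ind[OF A], rule integrable_uniform_circle[OF g_cont])
        also have "\<dots> \<le> (\<Sum>k=1..n. g F (?w k)) / n + \<delta>" using avgF by simp
        also have "(\<Sum>k=1..n. g F (?w k)) \<le> (\<Sum>k=1..n. (if k \<in> ?far then 1 else 0) + (if z n k \<in> ?B then 1 else 0))"
        proof (rule sum_mono)
          fix k assume k: "k \<in> {1..n}"
          have "z n k \<in> ?B" if far: "k \<notin> ?far" and g: "g F (?w k) \<noteq> 0"
          proof -
            obtain a where a: "a \<in> A" "dist (?w k) a < 4 * \<delta>" using gB[OF g] by blast
            have "dist (?w k) (z n k) < \<delta>" using near[of k] k far by blast
            then have "dist a (z n k) < e"
              using dist_triangle[of a "z n k" "?w k"] a \<delta> by (simp add: dist_commute)
            then show ?thesis using a by auto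
          qed
          then show "g F (?w k) \<le> (if k \<in> ?far then 1 else 0) + (if z n k \<in> ?B then 1 else 0)"
            using g1[of F "?w k"] by (cases "g F (?w k) = 0") auto
        qed
        also have "\<dots> = card ?far + card {k\<in>{1..n}. z n k \<in> ?B}"
          by (simp add: sum.distrib sum.If_cases Int_def)
        finally have "measure uniform_circle A \<le> card ?far / n + measure ?\<mu> ?B + \<delta>"
          using n by (simp add: measure_empirical_measure[OF B] add_divide_distrib divide_right_mono)
        then show ?thesis using farF \<delta> by linarith
      qed
      ultimately show ?thesis by blast
    qed
    let ?S = "{\<epsilon>. \<epsilon> > 0 \<and> (\<forall>A \<in> sets borel.
       measure ?\<mu> A \<le> measure uniform_circle (\<Union>x\<in>A. ball x \<epsilon>) + \<epsilon> \<and>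
       measure uniform_circle A \<le> measure ?\<mu> (\<Union>x\<in>A. ball x \<epsilon>) + \<epsilon>)}"
    have mem: "e \<in> ?S" using main e by (intro CollectI conjI ballI) simp_all
    have lb: "0 \<le> x" if "x \<in> ?S" for x using that by (simp only: mem_Collect_eq less_imp_le)
    have "Inf ?S \<le> e" by (rule cInf_lower[OF mem bdd_belowI[of ?S 0, OF lb]])
    moreover have "0 \<le> Inf ?S" by (rule cInf_greatest[OF _ lb]) (use mem in blast)
    ultimately show ?case using e0 unfolding levy_prokhorov_def e_def dist_real_def by linarith
  qed
qed

section \<open>Uniform log-concave sequences\<close>

text \<open>Truncated subtraction removes the terms with i >= j. The sum is the exponent in the
  Jacobian of the map that flattens a kink at j.\<close>

lemma sum_nat_diff: "j \<le> n \<Longrightarrow> (\<Sum>i\<le>n. real (j - i)) = real j * (real j + 1) / 2"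
proof (induction n rule: dec_induct)
  case base
  show ?case
  proof (induction j)
    case (Suc j)
    have "(\<Sum>i\<le>Suc j. real (Suc j - i)) = real (Suc j) + (\<Sum>i\<le>j. real (j - i))"
      by (subst sum.atMost_Suc_shift) simp
    then show ?case using Suc by (simp add: field_simps)
  qed simp
qed simp

definition log_slope :: "(nat \<Rightarrow> real) \<Rightarrow> nat \<Rightarrow> real" where
  "log_slope u i = ln (u i) - ln (u (i - 1))"

text \<open>The slope is taken to be \<open>0\<close> beyond \<open>n\<close>, so that on \<open>{1..n}\<close> the positive slopes are sums of
  their drops.\<close>
definition kink :: "nat \<Rightarrow> (nat \<Rightarrow> real) \<Rightarrow> nat \<Rightarrow> real \<Rightarrow> bool" where
  "kink n u j s \<longleftrightarrow>
     s + (if j < n then max 0 (log_slope u (j + 1)) else 0) \<le> max 0 (log_slope u j)"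

lemma log_concave_upto_iff_log_slope:
  assumes "\<And>i. i \<le> n \<Longrightarrow> 0 < u i"
  shows "log_concave_upto n u \<longleftrightarrow> (\<forall>i. 1 \<le> i \<and> i < n \<longrightarrow> log_slope u (i + 1) \<le> log_slope u i)"
proof -
  have "u (i - 1) * u (i + 1) \<le> (u i)\<^sup>2 \<longleftrightarrow> log_slope u (i + 1) \<le> log_slope u i"
    if "1 \<le> i" "i < n" for i
  proof -
    have pos: "0 < u (i - 1)" "0 < u i" "0 < u (i + 1)" using that by (auto intro!: assms)
    have "u (i - 1) * u (i + 1) \<le> (u i)\<^sup>2 \<longleftrightarrow> ln (u (i - 1) * u (i + 1)) \<le> ln ((u i)\<^sup>2)"
      using pos by (subst ln_le_cancel_iff) auto
    also have "\<dots> \<longleftrightarrow> log_slope u (i + 1) \<le> log_slope u i"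
      using pos by (auto simp: ln_mult_pos ln_realpow log_slope_def)
    finally show ?thesis .
  qed
  then show ?thesis unfolding log_concave_upto_def by blast
qed

lemma log_concave_upto_rev:
  assumes "log_concave_upto n u"
  shows "log_concave_upto n (\<lambda>i. u (n - i))"
  unfolding log_concave_upto_def
proof (intro allI impI)
  fix i assume i: "1 \<le> i \<and> i < n"
  then have "1 \<le> n - i \<and> n - i < n" by auto
  then have "u (n - i - 1) * u (n - i + 1) \<le> (u (n - i))\<^sup>2"
    using assms unfolding log_concave_upto_def by blast
  moreover have "n - (i - 1) = n - i + 1" "n - (i + 1) = n - i - 1" using i by auto
  ultimately show "u (n - (i - 1)) * u (n - (i + 1)) \<le> (u (n - i))\<^sup>2" by (simp add: mult.commute)
qed

lemma log_concave_upto_cong: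
  "(\<And>i. i \<le> n \<Longrightarrow> u i = v i) \<Longrightarrow> log_concave_upto n u \<longleftrightarrow> log_concave_upto n v"
  by (auto simp: log_concave_upto_def)

text \<open>Passing from u to v lowers the slopes at 1, ..., j by s and keeps the later ones. The
  drop at j leaves room for this, so slopes stay decreasing; those up to j stay nonnegative, so v
  increases up to \<open>v j = u j\<close>, which is below 1. Division by a factor in (0,1] is the
  form used by the measure estimate.\<close>

lemma flatten_kink:
  assumes u: "\<And>i. i \<le> n \<Longrightarrow> 0 < u i" "\<And>i. i \<le> n \<Longrightarrow> u i < 1" and lc: "log_concave_upto n u"
    and j: "1 \<le> j" "j \<le> n" and s: "s > 0" and k: "kink n u j s"
  defines "v \<equiv> \<lambda>i. u i / exp (- s * real (j - i))"
  shows "log_concave_upto n v" and "\<And>i. i \<le> n \<Longrightarrow> 0 < v i" and "\<And>i. i \<le> n \<Longrightarrow> v i < 1"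
proof -
  show pos: "0 < v i" if "i \<le> n" for i using u(1)[OF that] by (simp add: v_def)
  have lnv: "ln (v i) = ln (u i) + s * real (j - i)" if "i \<le> n" for i
    using u(1)[OF that] by (simp add: v_def ln_div)
  have slope: "log_slope v i = log_slope u i - (if i \<le> j then s else 0)" if "1 \<le> i" "i \<le> n" for i
  proof -
    have "real (j - i) - real (j - (i - 1)) = (if i \<le> j then - 1 else 0)" using that by auto
    then have "s * real (j - i) - s * real (j - (i - 1)) = (if i \<le> j then - s else 0)"
      unfolding right_diff_distrib[symmetric] by auto
    then show ?thesis using that by (simp add: log_slope_def lnv split: if_splits)
  qed
  have step: "log_slope u (i + 1) \<le> log_slope u i" if "1 \<le> i" "i < n" for i
    using lc that log_concave_upto_iff_log_slope[of n u] u(1) by auto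
  have anti: "log_slope u j \<le> log_slope u i" if "1 \<le> i" "i \<le> j" for i
    using that(2,1)
  proof (induction i rule: inc_induct)
    case (step m)
    have "log_slope u (m + 1) \<le> log_slope u m"
      using step.hyps step.prems j by (intro \<open>\<And>i. 1 \<le> i \<Longrightarrow> i < n \<Longrightarrow> _ i\<close>) auto
    then show ?case using step by simp
  qed simp
  \<comment> \<open>As s > 0, the positive part on the right of \<open>kink\<close> is positive and
    hence is the slope itself.\<close>
  have kj: "s \<le> log_slope u j" using k s by (auto simp: kink_def split: if_splits)
  have kj1: "log_slope u (j + 1) \<le> log_slope u j - s" if "j < n"
    using k s that by (auto simp: kink_def split: if_splits)
  show "log_concave_upto n v"
  proof (subst log_concave_upto_iff_log_slope, rule pos, assumption, intro allI impI)
    fix i assume i: "1 \<le> i \<and> i < n"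
    then show "log_slope v (i + 1) \<le> log_slope v i"
      using step[of i] kj1 by (cases "i = j") (auto simp: slope)
  qed
  show "v i < 1" if i: "i \<le> n" for i
  proof (cases "i \<le> j")
    case True
    then have "ln (v i) \<le> ln (v j)"
    proof (induction i rule: inc_induct)
      case (step m)
      have "0 \<le> log_slope v (Suc m)"
        using anti[of "Suc m"] kj step.hyps j by (subst slope) auto
      then show ?case using step by (simp add: log_slope_def)
    qed simp
    also have "ln (v j) = ln (u j)" by (simp add: v_def)
    also have "\<dots> < 0" using u j by simp
    finally show ?thesis using pos[OF i] by simp
  next
    case False
    then show ?thesis using u(2)[OF i] by (simp add: v_def)
  qed
qed

text \<open>The positive slopes D satisfy D j <= s j + D (j + 1). Summation by parts therefore
  bounds the sum of all D j, which dominates every rise of ln u above its initial value.\<close>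

lemma ln_le_of_no_kink:
  assumes s: "\<And>j. s j \<ge> 0" and nk: "\<And>j. j \<in> {1..n} \<Longrightarrow> \<not> kink n u j (s j)" and i: "i \<le> n"
  shows "ln (u i) \<le> ln (u 0) + (\<Sum>j=1..n. real j * s j)"
proof -
  define D where "D j = (if j \<le> n then max 0 (log_slope u j) else 0)" for j
  have D: "D j \<le> s j + D (j + 1)" if "j \<in> {1..n}" for j
    using nk[OF that] that by (auto simp: kink_def D_def split: if_splits)
  \<comment> \<open>The boundary term m * D (m + 1) carries the induction and disappears at m = n,
    where D (n + 1) = 0 by definition.\<close>
  have sum_D: "(\<Sum>j=1..m. D j) \<le> (\<Sum>j=1..m. real j * s j) + real m * D (m + 1)" if "m \<le> n" for m
    using that
  proof (induction m)
    case (Suc m)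
    have "real (Suc m) * D (Suc m) \<le> real (Suc m) * (s (Suc m) + D (Suc m + 1))"
      using D[of "Suc m"] Suc.prems by (intro mult_left_mono) auto
    then show ?case using Suc by (simp add: algebra_simps)
  qed simp
  have "ln (u i) - ln (u 0) = (\<Sum>j=1..i. log_slope u j)"
    by (induction i) (simp_all add: log_slope_def)
  also have "\<dots> \<le> (\<Sum>j=1..i. D j)" using i by (intro sum_mono) (auto simp: D_def)
  also have "\<dots> \<le> (\<Sum>j=1..n. D j)" using i by (intro sum_mono2) (auto simp: D_def)
  also have "\<dots> \<le> (\<Sum>j=1..n. real j * s j)" using sum_D[of n] by (simp add: D_def)
  finally show ?thesis by simp
qed

section \<open>Diagonal scalings under the conditioned law\<close>

lemma prob_space_uniform01: "prob_space (uniform_measure lborel {0<..<1::real})"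
  by (rule prob_space_uniform_measure) auto

text \<open>Since c <= 1, the scaled copy of A \<inter> (0,1) stays inside (0,1), so both sides are
  Lebesgue measures and linear substitution applies.\<close>

lemma emeasure_uniform01_scale:
  assumes c: "0 < c" "c \<le> 1" and A: "A \<in> sets borel"
  shows "emeasure (uniform_measure lborel {0<..<1::real}) {x. x / c \<in> A \<inter> {0<..<1}}
       = ennreal c * emeasure (uniform_measure lborel {0<..<1}) A"
proof -
  let ?S = "{x. x / c \<in> A \<inter> {0<..<1}}"
  have [measurable]: "A \<in> sets borel" by (rule A)
  have S: "?S \<in> sets borel" by measurable
  have "x < 1" if "x / c < 1" for x using that c by (simp add: field_simps)
  then have "{0<..<1} \<inter> ?S = ?S" using c by (auto simp: zero_less_divide_iff)
  then have "emeasure (uniform_measure lborel {0<..<1::real}) ?S = emeasure lborel ?S"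
    using S by (simp add: emeasure_uniform_measure divide_ennreal_def)
  also have "\<dots> = (\<integral>\<^sup>+x. indicator ?S x \<partial>lborel)" using S by simp
  also have "\<dots> = ennreal \<bar>c\<bar> * (\<integral>\<^sup>+x. indicator ?S (0 + c * x) \<partial>lborel)"
    using c S by (intro nn_integral_real_affine) auto
  also have "(\<lambda>x. indicator ?S (0 + c * x)) = (indicator ({0<..<1} \<inter> A) :: real \<Rightarrow> ennreal)"
    using c by (auto simp: indicator_def fun_eq_iff)
  also have "(\<integral>\<^sup>+x. indicator ({0<..<1} \<inter> A) x \<partial>lborel) = emeasure lborel ({0<..<1} \<inter> A)" by simp
  also have "\<dots> = emeasure (uniform_measure lborel {0<..<1}) A"
    using A by (simp add: emeasure_uniform_measure divide_ennreal_def)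
  finally show ?thesis using c by simp
qed

lemma sets_iid_uniform [measurable_cong]: "sets (iid_uniform n) = sets (PiM {..n} (\<lambda>_. borel))"
  unfolding iid_uniform_def by (rule sets_PiM_cong) auto

lemma space_iid_uniform: "space (iid_uniform n) = PiE {..n} (\<lambda>_. UNIV)"
  unfolding iid_uniform_def by (simp add: space_PiM)

text \<open>Change of variables for a diagonal map, obtained from uniqueness of product measures:
  the image measure, restricted to the open unit cube and divided by the Jacobian, agrees with the
  product measure on boxes.\<close>

lemma emeasure_iid_uniform_scale:
  assumes c: "\<And>i. i \<le> n \<Longrightarrow> 0 < c i" "\<And>i. i \<le> n \<Longrightarrow> c i \<le> 1"
    and X: "X \<in> sets (iid_uniform n)" "X \<subseteq> PiE {..n} (\<lambda>_. {0<..<1})"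
  shows "emeasure (iid_uniform n) {u \<in> space (iid_uniform n). (\<lambda>i\<in>{..n}. u i / c i) \<in> X}
       = ennreal (\<Prod>i\<le>n. c i) * emeasure (iid_uniform n) X"
proof -
  let ?U = "uniform_measure lborel {0<..<1::real}"
  let ?N = "iid_uniform n"
  let ?B = "PiE {..n} (\<lambda>_. {0<..<1::real})"
  let ?T = "\<lambda>u. \<lambda>i\<in>{..n}. u i / c i"
  let ?c = "\<Prod>i\<le>n. c i"
  interpret product_sigma_finite "\<lambda>_::nat. ?U"
    by (intro product_sigma_finite.intro prob_space_imp_sigma_finite prob_space_uniform01)
  have cpos: "?c > 0" using c by (intro prod_pos) auto
  have div_self: "1 / x * x = 1" if "0 < x" for x :: real using that by simp
  have k: "ennreal (1 / ?c) * (ennreal ?c * y) = y" for y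
  proof -
    have "ennreal (1 / ?c) * ennreal ?c = ennreal (1 / ?c * ?c)"
      using cpos by (intro ennreal_mult[symmetric]) auto
    also have "1 / ?c * ?c = 1" by (rule div_self[OF cpos])
    finally show ?thesis by (simp add: mult.assoc[symmetric])
  qed
  have T[measurable]: "?T \<in> ?N \<rightarrow>\<^sub>M ?N" unfolding iid_uniform_def by measurable
  have B[measurable]: "?B \<in> sets ?N" unfolding iid_uniform_def by (rule sets_PiM_I_finite) auto
  \<comment> \<open>The indicator of the cube discards the part of the image that leaves it; X lies
    in the cube, so nothing of X is lost.\<close>
  let ?P = "density (distr ?N ?N ?T) (\<lambda>v. ennreal (1 / ?c) * indicator ?B v)"
  have emP: "emeasure ?P Y = ennreal (1 / ?c) * emeasure ?N {u \<in> space ?N. ?T u \<in> ?B \<inter> Y}"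
    if Y: "Y \<in> sets ?N" for Y
  proof -
    have "emeasure ?P Y = (\<integral>\<^sup>+v. ennreal (1 / ?c) * indicator (?B \<inter> Y) v \<partial>distr ?N ?N ?T)"
      using Y by (subst emeasure_density) (auto intro!: nn_integral_cong simp: indicator_def)
    also have "\<dots> = ennreal (1 / ?c) * emeasure (distr ?N ?N ?T) (?B \<inter> Y)"
      using Y B by (intro nn_integral_cmult_indicator) auto
    also have "emeasure (distr ?N ?N ?T) (?B \<inter> Y) = emeasure ?N {u \<in> space ?N. ?T u \<in> ?B \<inter> Y}"
    proof (subst emeasure_distr[OF T])
      show "?B \<inter> Y \<in> sets ?N" using Y B by blast
      show "emeasure ?N (?T -` (?B \<inter> Y) \<inter> space ?N) = emeasure ?N {u \<in> space ?N. ?T u \<in> ?B \<inter> Y}"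
        by (rule arg_cong[where f = "emeasure ?N"]) blast
    qed
    finally show ?thesis .
  qed
  have "?P = PiM {..n} (\<lambda>_. ?U)"
  proof (rule PiM_eqI)
    fix A :: "nat \<Rightarrow> real set" assume A: "\<And>i. i \<in> {..n} \<Longrightarrow> A i \<in> sets ?U"
    then have Y: "PiE {..n} A \<in> sets ?N" unfolding iid_uniform_def by (intro sets_PiM_I_finite) auto
    have pre: "{u \<in> space ?N. ?T u \<in> ?B \<inter> PiE {..n} A}
        = PiE {..n} (\<lambda>i. {x. x / c i \<in> A i \<inter> {0<..<1}})"
    proof (rule set_eqI)
      fix u
      have "?T u \<in> ?B \<inter> PiE {..n} A \<longleftrightarrow> (\<forall>i\<in>{..n}. u i / c i \<in> A i \<inter> {0<..<1})"
        unfolding Int_iff PiE_iff by (simp only: restrict_extensional restrict_apply' cong: ball_cong) blast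
      then show "u \<in> {u \<in> space ?N. ?T u \<in> ?B \<inter> PiE {..n} A}
          \<longleftrightarrow> u \<in> PiE {..n} (\<lambda>i. {x. x / c i \<in> A i \<inter> {0<..<1}})"
        by (simp only: mem_Collect_eq PiE_iff space_iid_uniform UNIV_I) blast
    qed
    have "emeasure ?N (PiE {..n} (\<lambda>i. {x. x / c i \<in> A i \<inter> {0<..<1}}))
        = (\<Prod>i\<le>n. emeasure ?U {x. x / c i \<in> A i \<inter> {0<..<1}})"
      unfolding iid_uniform_def
    proof (rule emeasure_PiM)
      fix i assume "i \<in> {..n}"
      then have [measurable]: "A i \<in> sets borel" using A by simp
      show "{x. x / c i \<in> A i \<inter> {0<..<1}} \<in> sets ?U" by simp
    qed simp
    also have "\<dots> = (\<Prod>i\<le>n. ennreal (c i) * emeasure ?U (A i))"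
      using c A by (intro prod.cong refl emeasure_uniform01_scale) auto
    also have "\<dots> = ennreal ?c * (\<Prod>i\<le>n. emeasure ?U (A i))"
    proof -
      have "(\<Prod>i\<le>n. ennreal (c i)) = ennreal ?c"
        by (rule prod_ennreal) (use c in \<open>auto intro: less_imp_le\<close>)
      then show ?thesis by (simp add: prod.distrib)
    qed
    finally have scaled: "emeasure ?N {u \<in> space ?N. ?T u \<in> ?B \<inter> PiE {..n} A}
        = ennreal ?c * (\<Prod>i\<le>n. emeasure ?U (A i))"
      unfolding pre .
    show "emeasure ?P (PiE {..n} A) = (\<Prod>i\<le>n. emeasure ?U (A i))"
      unfolding emP[OF Y] scaled by (rule k)
  qed (simp_all add: iid_uniform_def)
  then have "emeasure ?P X = emeasure ?N X" by (simp only: iid_uniform_def)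
  moreover have "?B \<inter> X = X" using X(2) by (rule Int_absorb1)
  ultimately have "emeasure ?N X = ennreal (1 / ?c) * emeasure ?N {u \<in> space ?N. ?T u \<in> X}"
    using emP[OF X(1)] by (simp only:)
  then have "ennreal ?c * emeasure ?N X
      = ennreal (1 / ?c) * (ennreal ?c * emeasure ?N {u \<in> space ?N. ?T u \<in> X})"
    by (simp only: mult.left_commute)
  then show ?thesis unfolding k by (rule sym)
qed

lemma AE_iid_uniform: "AE u in iid_uniform n. u \<in> PiE {..n} (\<lambda>_. {0<..<1})"
proof -
  have "AE u in iid_uniform n. \<forall>i\<in>{..n}. u i \<in> {0<..<1}"
    unfolding iid_uniform_def
    by (intro AE_finite_allI AE_PiM_component prob_space_uniform01 AE_uniform_measureI) auto
  then show ?thesis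
    using AE_space by eventually_elim (auto simp: space_iid_uniform PiE_iff)
qed

lemma sets_log_concave_upto:
  "{u \<in> space (iid_uniform n). log_concave_upto n u} \<in> sets (iid_uniform n)"
proof -
  have comp: "(\<lambda>u. u k) \<in> borel_measurable (iid_uniform n)" if "k \<le> n" for k
    unfolding measurable_cong_sets[OF sets_iid_uniform refl] using that
    by (intro measurable_component_singleton) simp
  have "{u \<in> space (iid_uniform n). \<forall>i\<in>{1..<n}. u (i - 1) * u (i + 1) \<le> (u i)\<^sup>2} \<in> sets (iid_uniform n)"
  proof (rule sets.sets_Collect_finite_All)
    fix i assume "i \<in> {1..<n}"
    then have i: "i - 1 \<le> n" "i + 1 \<le> n" "i \<le> n" by auto
    show "{u \<in> space (iid_uniform n). u (i - 1) * u (i + 1) \<le> (u i)\<^sup>2} \<in> sets (iid_uniform n)"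
      by (rule borel_measurable_le[OF borel_measurable_times[OF comp[OF i(1)] comp[OF i(2)]]
            borel_measurable_power[OF comp[OF i(3)]]])
  qed simp
  moreover have "log_concave_upto n u \<longleftrightarrow> (\<forall>i\<in>{1..<n}. u (i - 1) * u (i + 1) \<le> (u i)\<^sup>2)" for u
    unfolding log_concave_upto_def by (simp only: Ball_def atLeastLessThan_iff)
  ultimately show ?thesis by (simp only:)
qed

lemma AE_uniform_model: "AE u in uniform_model n. u \<in> PiE {..n} (\<lambda>_. {0<..<1})"
  unfolding uniform_model_def
  by (intro AE_uniform_measureI sets_log_concave_upto) (use AE_iid_uniform in eventually_elim, auto)

lemma sets_uniform_model [measurable_cong]: "sets (uniform_model n) = sets (PiM {..n} (\<lambda>_. borel))"
  by (simp add: uniform_model_def sets_iid_uniform)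

text \<open>The scaling takes almost every log-concave point of E to a log-concave point of the
  cube. So E \<inter> L is contained, up to a null set, in the preimage of L \<inter> B, whose mass
  is at most the Jacobian times that of L; conditioning divides by the mass of L.\<close>

lemma emeasure_uniform_model_le:
  assumes c: "\<And>i. i \<le> n \<Longrightarrow> 0 < c i" "\<And>i. i \<le> n \<Longrightarrow> c i \<le> 1"
    and E: "E \<in> sets (iid_uniform n)"
    and T: "\<And>u. u \<in> E \<Longrightarrow> (\<And>i. i \<le> n \<Longrightarrow> 0 < u i) \<Longrightarrow> (\<And>i. i \<le> n \<Longrightarrow> u i < 1) \<Longrightarrow>
       log_concave_upto n u \<Longrightarrow>
       log_concave_upto n (\<lambda>i. u i / c i) \<and> (\<forall>i\<le>n. 0 < u i / c i \<and> u i / c i < 1)"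
  shows "emeasure (uniform_model n) E \<le> ennreal (\<Prod>i\<le>n. c i)"
proof -
  let ?N = "iid_uniform n"
  let ?L = "{u \<in> space ?N. log_concave_upto n u}"
  let ?B = "PiE {..n} (\<lambda>_. {0<..<1::real})"
  have L: "?L \<in> sets ?N" by (rule sets_log_concave_upto)
  have B: "?B \<in> sets ?N" unfolding iid_uniform_def by (rule sets_PiM_I_finite) auto
  let ?S = "{u \<in> space ?N. (\<lambda>i\<in>{..n}. u i / c i) \<in> ?L \<inter> ?B}"
  have S: "?S \<in> sets ?N"
  proof -
    have [measurable]: "(\<lambda>u. \<lambda>i\<in>{..n}. u i / c i) \<in> ?N \<rightarrow>\<^sub>M ?N" unfolding iid_uniform_def by measurable
    have [measurable]: "?L \<inter> ?B \<in> sets ?N" using L B by blast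
    show ?thesis by measurable
  qed
  have "emeasure ?N (?L \<inter> E) \<le> emeasure ?N ?S"
  proof (rule emeasure_mono_AE)
    show "AE u in ?N. u \<in> ?L \<inter> E \<longrightarrow> u \<in> ?S"
      using AE_iid_uniform[of n]
    proof eventually_elim
      case (elim u)
      show ?case
      proof
        assume u: "u \<in> ?L \<inter> E"
        have "log_concave_upto n (\<lambda>i. u i / c i) \<and> (\<forall>i\<le>n. 0 < u i / c i \<and> u i / c i < 1)"
          using u elim by (intro T) (auto simp: PiE_iff)
        then show "u \<in> ?S" using u
          by (auto simp: space_iid_uniform PiE_iff log_concave_upto_cong[of n "\<lambda>i\<in>{..n}. u i / c i" "\<lambda>i. u i / c i"])
      qed
    qed
  qed (rule S)
  also have "\<dots> = ennreal (\<Prod>i\<le>n. c i) * emeasure ?N (?L \<inter> ?B)"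
    using L B by (intro emeasure_iid_uniform_scale c) auto
  also have "\<dots> \<le> ennreal (\<Prod>i\<le>n. c i) * emeasure ?N ?L"
    using L by (intro mult_left_mono emeasure_mono) auto
  finally have le: "emeasure ?N (?L \<inter> E) \<le> emeasure ?N ?L * ennreal (\<Prod>i\<le>n. c i)"
    by (simp add: mult.commute)
  have "emeasure (uniform_model n) E = emeasure ?N (?L \<inter> E) / emeasure ?N ?L"
    unfolding uniform_model_def using L E by (rule emeasure_uniform_measure)
  also have "\<dots> \<le> ennreal (\<Prod>i\<le>n. c i)"
  proof (cases "emeasure ?N ?L = 0")
    \<comment> \<open>The quotient 0 / 0 is 0 in \<open>ennreal\<close>, which settles a
      conditioning event of mass zero.\<close>
    case True
    then have "emeasure ?N (?L \<inter> E) = 0" using le by simp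
    then show ?thesis by simp
  next
    case False
    then show ?thesis using le by (intro divide_le_posI_ennreal) (auto simp: zero_less_iff_neq_zero)
  qed
  finally show ?thesis .
qed

section \<open>Probability of kinks\<close>

lemma sets_kink:
  assumes "j \<in> {1..n}"
  shows "{u \<in> space (iid_uniform n). kink n u j s} \<in> sets (iid_uniform n)"
    and "{u \<in> space (iid_uniform n). kink n (\<lambda>i. u (n - i)) j s} \<in> sets (iid_uniform n)"
proof -
  have comp: "(\<lambda>u. ln (u k)) \<in> borel_measurable (iid_uniform n)" if "k \<le> n" for k
    unfolding measurable_cong_sets[OF sets_iid_uniform refl] using that
    by (intro borel_measurable_ln measurable_component_singleton) simp
  have *: "{u \<in> space (iid_uniform n). kink n (\<lambda>i. u (f i)) j s} \<in> sets (iid_uniform n)"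
    if f: "\<And>i. i \<le> n \<Longrightarrow> f i \<le> n" for f
  proof -
    have slope: "(\<lambda>u. log_slope (\<lambda>i. u (f i)) k) \<in> borel_measurable (iid_uniform n)" if "k \<le> n" for k
      unfolding log_slope_def using that by (intro borel_measurable_diff comp f) auto
    have "(\<lambda>u. if j < n then max 0 (log_slope (\<lambda>i. u (f i)) (j + 1)) else 0) \<in> borel_measurable (iid_uniform n)"
      by (cases "j < n") (auto intro!: borel_measurable_max slope)
    then show ?thesis
      unfolding kink_def using assms
      by (intro borel_measurable_le borel_measurable_add borel_measurable_max slope) auto
  qed
  show "{u \<in> space (iid_uniform n). kink n u j s} \<in> sets (iid_uniform n)"
    using *[of "\<lambda>i. i"] by simp
  show "{u \<in> space (iid_uniform n). kink n (\<lambda>i. u (n - i)) j s} \<in> sets (iid_uniform n)"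
    by (rule *) simp
qed

text \<open>Flattening the kink is a scaling by exp (- s (j - i)) in coordinate i, and these factors
  multiply to the stated exponential. For the reversed sequence the same factors occur in reverse
  order.\<close>

lemma emeasure_kink_le:
  assumes j: "j \<in> {1..n}" and s: "s > 0"
  shows "emeasure (uniform_model n) {u \<in> space (iid_uniform n). kink n u j s}
           \<le> ennreal (exp (- s * (real j * (real j + 1) / 2)))"
    and "emeasure (uniform_model n) {u \<in> space (iid_uniform n). kink n (\<lambda>i. u (n - i)) j s}
           \<le> ennreal (exp (- s * (real j * (real j + 1) / 2)))"
proof -
  have prod: "(\<Prod>i\<le>n. exp (- s * real (j - i))) = exp (- s * (real j * (real j + 1) / 2))"
    using j sum_nat_diff[of j n] by (simp add: exp_sum[symmetric] sum_distrib_left[symmetric] sum_negf)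
  also have "(\<Prod>i\<le>n. exp (- s * real (j - i))) = (\<Prod>i\<le>n. exp (- s * real (j - (n - i))))"
    by (rule prod.reindex_bij_witness[of _ "\<lambda>i. n - i" "\<lambda>i. n - i"]) auto
  finally have prod': "\<dots> = exp (- s * (real j * (real j + 1) / 2))" by simp
  show "emeasure (uniform_model n) {u \<in> space (iid_uniform n). kink n u j s}
           \<le> ennreal (exp (- s * (real j * (real j + 1) / 2)))"
    unfolding prod[symmetric]
  proof (rule emeasure_uniform_model_le)
    fix u assume "u \<in> {u \<in> space (iid_uniform n). kink n u j s}"
      "\<And>i. i \<le> n \<Longrightarrow> 0 < u i" "\<And>i. i \<le> n \<Longrightarrow> u i < 1" "log_concave_upto n u"
    then show "log_concave_upto n (\<lambda>i. u i / exp (- s * real (j - i))) \<and>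
      (\<forall>i\<le>n. 0 < u i / exp (- s * real (j - i)) \<and> u i / exp (- s * real (j - i)) < 1)"
      using flatten_kink[of n u j s] j s by auto
  qed (use j s in \<open>auto intro: sets_kink\<close>)
  show "emeasure (uniform_model n) {u \<in> space (iid_uniform n). kink n (\<lambda>i. u (n - i)) j s}
           \<le> ennreal (exp (- s * (real j * (real j + 1) / 2)))"
    unfolding prod'[symmetric]
  proof (rule emeasure_uniform_model_le)
    fix u assume u: "u \<in> {u \<in> space (iid_uniform n). kink n (\<lambda>i. u (n - i)) j s}"
      "\<And>i. i \<le> n \<Longrightarrow> 0 < u i" "\<And>i. i \<le> n \<Longrightarrow> u i < 1" "log_concave_upto n u"
    let ?v = "\<lambda>i. u (n - i) / exp (- s * real (j - i))"
    have v: "log_concave_upto n ?v" "\<And>i. i \<le> n \<Longrightarrow> 0 < ?v i" "\<And>i. i \<le> n \<Longrightarrow> ?v i < 1"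
      using flatten_kink[of n "\<lambda>i. u (n - i)" j s] j s u log_concave_upto_rev[OF u(4)] by auto
    have eq: "?v (n - i) = u i / exp (- s * real (j - (n - i)))" if "i \<le> n" for i
      using that by simp
    have "log_concave_upto n (\<lambda>i. u i / exp (- s * real (j - (n - i))))"
      using log_concave_upto_rev[OF v(1)] by (subst log_concave_upto_cong[OF eq[symmetric]])
    moreover have "0 < u i / exp (- s * real (j - (n - i))) \<and> u i / exp (- s * real (j - (n - i))) < 1"
      if "i \<le> n" for i
      using v(2,3)[of "n - i"] unfolding eq[OF that] by simp
    ultimately show "log_concave_upto n (\<lambda>i. u i / exp (- s * real (j - (n - i)))) \<and>
      (\<forall>i\<le>n. 0 < u i / exp (- s * real (j - (n - i))) \<and> u i / exp (- s * real (j - (n - i))) < 1)"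
      by blast
  qed (use j s in \<open>auto intro: sets_kink\<close>)
qed

text \<open>With this choice every kink has probability at most \<open>n\<^sup>-\<^sup>3\<close>.\<close>
definition kink_size :: "nat \<Rightarrow> nat \<Rightarrow> real" where
  "kink_size n j = 6 * ln (real n) / (real j * (real j + 1))"

text \<open>The summand is 6 ln n / (j + 1), and the harmonic sum telescopes against 1 / (m + 2) <=
  ln ((m + 2) / (m + 1)).\<close>

lemma sum_kink_size_le: "n \<ge> 1 \<Longrightarrow> (\<Sum>j=1..n. real j * kink_size n j) \<le> 6 * ln (real n) * ln (real n + 1)"
proof -
  assume n: "n \<ge> 1"
  have "(\<Sum>j=1..m. 1 / (real j + 1)) \<le> ln (real m + 1)" for m
  proof (induction m)
    case (Suc m)
    have "ln ((real m + 1) / (real m + 2)) \<le> (real m + 1) / (real m + 2) - 1"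
      by (rule ln_le_minus_one) simp
    then have "1 / (real m + 2) \<le> ln (real m + 2) - ln (real m + 1)"
      by (simp add: ln_div field_simps)
    then show ?case using Suc by (simp add: add_ac)
  qed simp
  then have "6 * ln (real n) * (\<Sum>j=1..n. 1 / (real j + 1)) \<le> 6 * ln (real n) * ln (real n + 1)"
    using n by (intro mult_left_mono) auto
  also have "6 * ln (real n) * (\<Sum>j=1..n. 1 / (real j + 1)) = (\<Sum>j=1..n. real j * kink_size n j)"
    unfolding sum_distrib_left by (intro sum.cong refl) (auto simp: kink_size_def)
  finally show ?thesis .
qed

text \<open>Kinks of the reversed sequence are included so that on the complement both end
  coefficients control all the others.\<close>

definition bad_set :: "nat \<Rightarrow> (nat \<Rightarrow> real) set" where
  "bad_set n = (\<Union>j\<in>{1..n}. {u \<in> space (iid_uniform n). kink n u j (kink_size n j)} \<union>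
       {u \<in> space (iid_uniform n). kink n (\<lambda>i. u (n - i)) j (kink_size n j)})"

lemma sets_bad_set: "bad_set n \<in> sets (iid_uniform n)"
  unfolding bad_set_def by (intro sets.finite_UN sets.Un sets_kink) auto

text \<open>A union bound over 2n events of probability at most n^-3 each. The condition n >= 2
  makes ln n, and with it every kink size, positive.\<close>

lemma emeasure_bad_set_le:
  assumes n: "n \<ge> 2"
  shows "emeasure (uniform_model n) (bad_set n) \<le> ennreal (2 / (real n)\<^sup>2)"
proof -
  have N: "sets (uniform_model n) = sets (iid_uniform n)" by (simp add: sets_uniform_model sets_iid_uniform)
  have kp: "exp (- kink_size n j * (real j * (real j + 1) / 2)) = 1 / (real n) ^ 3" if "j \<in> {1..n}" for j
  proof -
    have "- kink_size n j * (real j * (real j + 1) / 2) = - (real 3 * ln (real n))"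
      using that by (simp add: kink_size_def)
    moreover have "exp (real 3 * ln (real n)) = real n ^ 3"
      unfolding exp_of_nat_mult using n by simp
    ultimately show ?thesis by (simp only: exp_minus inverse_eq_divide)
  qed
  have ks: "kink_size n j > 0" if "j \<in> {1..n}" for j using that n by (auto simp: kink_size_def)
  have "emeasure (uniform_model n) (bad_set n) \<le> (\<Sum>j\<in>{1..n}. emeasure (uniform_model n)
     ({u \<in> space (iid_uniform n). kink n u j (kink_size n j)} \<union>
       {u \<in> space (iid_uniform n). kink n (\<lambda>i. u (n - i)) j (kink_size n j)}))"
    unfolding bad_set_def
    by (rule emeasure_subadditive_finite) (auto simp: N intro!: sets.Un sets_kink)
  also have "\<dots> \<le> (\<Sum>j\<in>{1..n}. ennreal (1 / (real n) ^ 3) + ennreal (1 / (real n) ^ 3))"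
  proof (rule sum_mono)
    fix j assume j: "j \<in> {1..n}"
    show "emeasure (uniform_model n)
     ({u \<in> space (iid_uniform n). kink n u j (kink_size n j)} \<union>
       {u \<in> space (iid_uniform n). kink n (\<lambda>i. u (n - i)) j (kink_size n j)})
       \<le> ennreal (1 / (real n) ^ 3) + ennreal (1 / (real n) ^ 3)"
      by (rule order.trans[OF emeasure_subadditive])
         (use j sets_kink[OF j] emeasure_kink_le[OF j ks[OF j], unfolded kp[OF j]] in \<open>auto simp: N intro!: add_mono\<close>)
  qed
  also have "ennreal (1 / (real n) ^ 3) + ennreal (1 / (real n) ^ 3) = ennreal (2 / (real n) ^ 3)"
    by (simp add: ennreal_plus[symmetric] del: ennreal_plus)
  also have "(\<Sum>j\<in>{1..n}. ennreal (2 / (real n) ^ 3)) = ennreal (\<Sum>j\<in>{1..n}. 2 / (real n) ^ 3)"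
    by (rule sum_ennreal) simp
  also have "(\<Sum>j\<in>{1..n}. 2 / (real n) ^ 3) = 2 / (real n)\<^sup>2"
    using n by (simp add: power2_eq_square power3_eq_cube)
  finally show ?thesis .
qed

lemma coeff_ratio_of_not_bad:
  assumes u: "u \<in> space (iid_uniform n)" "u \<notin> bad_set n" and pos: "\<And>i. i \<le> n \<Longrightarrow> 0 < u i"
    and n: "n \<ge> 1" and i: "i \<le> n"
  shows "u i \<le> exp (6 * ln (real n) * ln (real n + 1)) * u 0"
    and "u i \<le> exp (6 * ln (real n) * ln (real n + 1)) * u n"
proof -
  let ?R = "6 * ln (real n) * ln (real n + 1)"
  have ks: "kink_size n j \<ge> 0" for j using n by (auto simp: kink_size_def)
  have exp: "x \<le> exp ?R * y" if "0 < x" "0 < y" "ln x \<le> ln y + ?R" for x y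
  proof -
    have "exp (ln x) \<le> exp (ln y + ?R)" using that(3) by (simp only: exp_le_cancel_iff)
    then show ?thesis using that by (simp add: exp_add mult.commute)
  qed
  have "ln (u i) \<le> ln (u 0) + ?R"
    using ln_le_of_no_kink[of "kink_size n" n u i] sum_kink_size_le[OF n] ks u i
    by (force simp: bad_set_def)
  then show "u i \<le> exp ?R * u 0" using pos i by (intro exp) auto
  have "ln (u (n - (n - i))) \<le> ln (u (n - 0)) + ?R"
    using ln_le_of_no_kink[of "kink_size n" n "\<lambda>i. u (n - i)" "n - i"] sum_kink_size_le[OF n] ks u i
    by (force simp: bad_set_def)
  then show "u i \<le> exp ?R * u n" using pos i by (intro exp) auto
qed

section \<open>Equidistribution of the roots\<close>

text \<open>The deterministic half of the argument: H n = R n + ln (n + 1) is o(n), so after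
  division by n both the power sums of the projected roots and the number of roots away from the
  circle become negligible.\<close>

lemma roots_equidistribute:
  fixes r :: "nat \<Rightarrow> nat \<Rightarrow> complex" and u :: "nat \<Rightarrow> nat \<Rightarrow> real"
  assumes roots: "\<forall>\<^sub>F n in sequentially.
      image_mset (r n) (mset_set {1..n}) = proots (coeff_poly n (u n))"
    and pos: "\<forall>\<^sub>F n in sequentially. \<forall>i\<le>n. 0 < u n i"
    and u0: "\<forall>\<^sub>F n in sequentially. \<forall>i\<le>n. u n i \<le> exp (R n) * u n 0"
    and un: "\<forall>\<^sub>F n in sequentially. \<forall>i\<le>n. u n i \<le> exp (R n) * u n n"
    and R: "(\<lambda>n. R n / n) \<longlonglongrightarrow> 0" "\<And>n. n \<ge> 1 \<Longrightarrow> R n \<ge> 0"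
  shows "(\<lambda>n. levy_prokhorov (empirical_measure n (r n)) uniform_circle) \<longlonglongrightarrow> 0"
proof -
  define H where "H n = R n + ln (real n + 1)" for n
  have "(\<lambda>n. ln (real n + 1) / n) \<longlonglongrightarrow> 0" by real_asymp
  from tendsto_add[OF R(1) this] have Hlim: "(\<lambda>n. H n / n) \<longlonglongrightarrow> 0"
    by (simp add: H_def add_divide_distrib)
  have main: "\<forall>\<^sub>F n in sequentially. 0 < n \<and> (\<forall>k\<in>{1..n}. r n k \<noteq> 0) \<and>
      (\<forall>m\<ge>1. norm (\<Sum>k=1..n. sgn (r n k) ^ m) \<le> 2 * H n * m * 2 ^ m) \<and>
      (\<forall>\<delta>. 0 < \<delta> \<longrightarrow> \<delta> \<le> 1 \<longrightarrow>
        real (card {k\<in>{1..n}. \<bar>norm (r n k) - 1\<bar> \<ge> \<delta>}) * ln (1 + \<delta>\<^sup>2 / 8) \<le> 2 * H n)"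
    using roots pos u0 un eventually_gt_at_top[of 0]
  proof eventually_elim
    case (elim n)
    have H: "H n > 0" using R(2)[of n] elim(5) by (auto simp: H_def intro!: add_nonneg_pos)
    have nz: "r n k \<noteq> 0" if "k \<in> {1..n}" for k
      by (rule coeff_poly_roots(1)[OF elim(1) _ H, of "R n"]) (use elim that in \<open>auto simp: H_def\<close>)
    have bd: "(norm (\<Prod>k=1..n. z - r n k))\<^sup>2 \<le> exp (2 * H n) * (\<Prod>k=1..n. norm (r n k))"
      if "norm z = 1" for z
      using that by (intro coeff_poly_roots(2)[OF elim(1) _ H, of "R n"]) (use elim in \<open>auto simp: H_def\<close>)
    note near = roots_near_circle_and_power_sums[of "{1..n}" "r n" "H n", OF finite_atLeastAtMost nz H bd]
    show ?case
    proof (intro conjI ballI allI impI)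
      fix k assume "k \<in> {1..n}" then show "r n k \<noteq> 0" by (rule nz)
    next
      fix m :: nat assume "1 \<le> m"
      then show "norm (\<Sum>k=1..n. sgn (r n k) ^ m) \<le> 2 * H n * m * 2 ^ m" by (intro near(1))
    next
      fix \<delta> :: real assume "0 < \<delta>" "\<delta> \<le> 1"
      then show "real (card {k\<in>{1..n}. \<bar>norm (r n k) - 1\<bar> \<ge> \<delta>}) * ln (1 + \<delta>\<^sup>2 / 8) \<le> 2 * H n"
        by (intro near(2))
    qed (rule elim(5))
  qed
  have nz: "\<forall>\<^sub>F n in sequentially. \<forall>k\<in>{1..n}. r n k \<noteq> 0"
    using main by eventually_elim blast
  show ?thesis
  proof (rule levy_prokhorov_empirical_tendsto[OF nz])
    fix \<delta> :: real assume \<delta>: "0 < \<delta>" "\<delta> \<le> 1"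
    let ?l = "ln (1 + \<delta>\<^sup>2 / 8)"
    have l: "?l > 0" by (rule ln_gt_zero) (use \<delta> in simp)
    have "(\<lambda>n. 2 / ?l * (H n / n)) \<longlonglongrightarrow> 2 / ?l * 0" by (intro tendsto_intros Hlim)
    then have lim: "(\<lambda>n. 2 / ?l * (H n / n)) \<longlonglongrightarrow> 0" by simp
    show "(\<lambda>n. card {k\<in>{1..n}. \<bar>norm (r n k) - 1\<bar> \<ge> \<delta>} / n) \<longlonglongrightarrow> 0"
    proof (rule tendsto_sandwich[OF _ _ tendsto_const lim])
      show "\<forall>\<^sub>F n in sequentially.
          card {k\<in>{1..n}. \<bar>norm (r n k) - 1\<bar> \<ge> \<delta>} / n \<le> 2 / ?l * (H n / n)"
        using main
      proof eventually_elim
        case (elim n)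
        then have "real (card {k\<in>{1..n}. \<bar>norm (r n k) - 1\<bar> \<ge> \<delta>}) * ?l \<le> 2 * H n" using \<delta> by blast
        then have "card {k\<in>{1..n}. \<bar>norm (r n k) - 1\<bar> \<ge> \<delta>} \<le> 2 * H n / ?l"
          using l by (simp only: pos_le_divide_eq)
        then have "card {k\<in>{1..n}. \<bar>norm (r n k) - 1\<bar> \<ge> \<delta>} / n \<le> 2 * H n / ?l / n"
          by (rule divide_right_mono) simp
        then show ?case by (simp only: times_divide_eq_left times_divide_eq_right divide_divide_eq_left)
      qed
    qed simp
  next
    fix g :: "complex \<Rightarrow> real" assume g: "continuous_on UNIV g"
    show "(\<lambda>n. (\<Sum>k=1..n. g (sgn (r n k))) / n) \<longlonglongrightarrow> (\<integral>x. g x \<partial>uniform_circle)"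
    proof (rule weyl_equidistribution[OF _ _ g])
      show "\<forall>\<^sub>F n in sequentially. \<forall>k\<in>{1..n}. norm (sgn (r n k)) = 1"
        using nz by eventually_elim (simp add: norm_sgn)
      fix m :: nat assume m: "m \<ge> 1"
      have "(\<lambda>n. 2 * real m * 2 ^ m * (H n / n)) \<longlonglongrightarrow> 2 * real m * 2 ^ m * 0" by (intro tendsto_intros Hlim)
      then have lim: "(\<lambda>n. 2 * real m * 2 ^ m * (H n / n)) \<longlonglongrightarrow> 0" by simp
      show "(\<lambda>n. (\<Sum>k=1..n. sgn (r n k) ^ m) / n) \<longlonglongrightarrow> 0"
      proof (rule Lim_null_comparison[OF _ lim])
        show "\<forall>\<^sub>F n in sequentially.
            norm ((\<Sum>k=1..n. sgn (r n k) ^ m) / n) \<le> 2 * real m * 2 ^ m * (H n / n)"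
          using main
        proof eventually_elim
          case (elim n)
          then have "norm (\<Sum>k=1..n. sgn (r n k) ^ m) \<le> 2 * H n * m * 2 ^ m" using m by blast
          then have "norm (\<Sum>k=1..n. sgn (r n k) ^ m) / n \<le> 2 * H n * m * 2 ^ m / n"
            by (rule divide_right_mono) simp
          then show ?case by (simp add: norm_divide mult_ac)
        qed
      qed
    qed
  qed
qed

theorem theorem1:
  fixes M :: "'w measure"
    and a :: "nat \<Rightarrow> nat \<Rightarrow> 'w \<Rightarrow> real"
    and \<zeta> :: "nat \<Rightarrow> nat \<Rightarrow> 'w \<Rightarrow> complex"
  assumes "prob_space M"
    and "\<And>n i. n \<ge> 1 \<Longrightarrow> i \<le> n \<Longrightarrow> a n i \<in> borel_measurable M"
    and "\<And>n. n \<ge> 1 \<Longrightarrow>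
           distr M (PiM {..n} (\<lambda>_. borel)) (\<lambda>\<omega>. \<lambda>i\<in>{..n}. a n i \<omega>) = uniform_model n"
    and "\<And>n. n \<ge> 1 \<Longrightarrow> AE \<omega> in M.
           image_mset (\<lambda>k. \<zeta> n k \<omega>) (mset_set {1..n}) = proots (coeff_poly n (\<lambda>i. a n i \<omega>))"
  shows "AE \<omega> in M.
           (\<lambda>n. levy_prokhorov (empirical_measure n (\<lambda>k. \<zeta> n k \<omega>)) uniform_circle) \<longlonglongrightarrow> 0"
proof -
  interpret prob_space M by (rule assms(1))
  let ?X = "\<lambda>n \<omega>. \<lambda>i\<in>{..n}. a n i \<omega>"
  have X[measurable]: "?X n \<in> M \<rightarrow>\<^sub>M PiM {..n} (\<lambda>_. borel)" if "n \<ge> 1" for n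
    by (rule measurable_restrict) (rule assms(2)[OF that], simp)
  have sets: "sets (iid_uniform n) = sets (PiM {..n} (\<lambda>_. borel))" for n by (rule sets_iid_uniform)
  define E where "E n = (if n \<ge> 2 then ?X n -` bad_set n \<inter> space M else {})" for n
  have E: "E n \<in> sets M" for n
    using sets_bad_set[of n] X[of n] by (auto simp: E_def sets intro!: measurable_sets)
  have "measure M (E n) \<le> 2 / (real n)\<^sup>2" for n
  proof (cases "n \<ge> 2")
    case True
    then have n1: "n \<ge> 1" by simp
    have "emeasure M (E n) = emeasure (distr M (PiM {..n} (\<lambda>_. borel)) (?X n)) (bad_set n)"
      using True sets_bad_set[of n] by (simp add: E_def emeasure_distr[OF X[OF n1]] sets)
    also have "\<dots> \<le> ennreal (2 / (real n)\<^sup>2)"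
      unfolding assms(3)[OF n1] using True by (rule emeasure_bad_set_le)
    finally show ?thesis by (simp add: emeasure_eq_measure)
  qed (simp add: E_def)
  then have "summable (\<lambda>n. measure M (E n))"
    by (intro summable_comparison_test'[OF summable_mult[OF inverse_power_summable[of 2], of 2], of 0])
       (auto simp: inverse_eq_divide)
  \<comment> \<open>The convergence half of Borel-Cantelli holds for every joint law of the
    different polynomials on M.\<close>
  then have bc: "AE \<omega> in M. \<forall>\<^sub>F n in sequentially. \<omega> \<in> space M - E n"
    by (intro borel_cantelli_AE1 E) (simp_all add: emeasure_eq_measure)
  have "AE \<omega> in M. ?X n \<omega> \<in> PiE {..n} (\<lambda>_. {0<..<1})" if n: "n \<ge> 1" for n
  proof -
    have "AE u in distr M (PiM {..n} (\<lambda>_. borel)) (?X n). u \<in> PiE {..n} (\<lambda>_. {0<..<1})"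
      unfolding assms(3)[OF n] by (rule AE_uniform_model)
    then show ?thesis by (rule AE_distrD[OF X[OF n]])
  qed
  \<comment> \<open>A countable union of null sets is null, so a single exceptional set serves all
    n.\<close>
  then have "AE \<omega> in M. \<forall>n\<ge>1. \<forall>i\<le>n. 0 < a n i \<omega>"
    unfolding AE_all_countable by (force simp: PiE_iff)
  moreover have "AE \<omega> in M. \<forall>n\<ge>1.
      image_mset (\<lambda>k. \<zeta> n k \<omega>) (mset_set {1..n}) = proots (coeff_poly n (\<lambda>i. a n i \<omega>))"
    unfolding AE_all_countable using assms(4) by simp
  ultimately show ?thesis
    using bc
  proof eventually_elim
    case (elim \<omega>)
    let ?R = "\<lambda>n::nat. 6 * ln (real n) * ln (real n + 1)"
    have ev: "\<forall>\<^sub>F n in sequentially. (\<forall>i\<le>n. a n i \<omega> \<le> exp (?R n) * a n 0 \<omega>) \<and>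
        (\<forall>i\<le>n. a n i \<omega> \<le> exp (?R n) * a n n \<omega>)"
      using elim(3) eventually_ge_at_top[of 2]
    proof eventually_elim
      case (elim n)
      have "?X n \<omega> \<in> space (iid_uniform n)" by (simp add: space_iid_uniform)
      moreover have "?X n \<omega> \<notin> bad_set n" using elim by (auto simp: E_def)
      moreover have "0 < ?X n \<omega> i" if "i \<le> n" for i
        using \<open>\<forall>n\<ge>1. \<forall>i\<le>n. 0 < a n i \<omega>\<close> elim that by simp
      ultimately show ?case
        using coeff_ratio_of_not_bad[of "?X n \<omega>" n] elim by simp
    qed
    show ?case
    proof (rule roots_equidistribute[where u = "\<lambda>n i. a n i \<omega>" and R = ?R])
      show "\<forall>\<^sub>F n in sequentially. image_mset (\<lambda>k. \<zeta> n k \<omega>) (mset_set {1..n})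
          = proots (coeff_poly n (\<lambda>i. a n i \<omega>))"
        using eventually_ge_at_top[of 1] by eventually_elim (use elim(2) in blast)
      show "\<forall>\<^sub>F n in sequentially. \<forall>i\<le>n. 0 < a n i \<omega>"
        using eventually_ge_at_top[of 1] by eventually_elim (use elim(1) in blast)
      show "\<forall>\<^sub>F n in sequentially. \<forall>i\<le>n. a n i \<omega> \<le> exp (?R n) * a n 0 \<omega>"
        using ev by eventually_elim (rule conjunct1)
      show "\<forall>\<^sub>F n in sequentially. \<forall>i\<le>n. a n i \<omega> \<le> exp (?R n) * a n n \<omega>"
        using ev by eventually_elim (rule conjunct2)
      show "(\<lambda>n. ?R n / real n) \<longlonglongrightarrow> 0" by real_asymp
      show "0 \<le> ?R n" if "n \<ge> 1" for n using that by simp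
    qed
  qed
qed

end
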